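(* Let $1<\alpha<2$, let $a<b$ be real numbers, and let $$\kappa_{1,\alpha}=\frac{B\left(\frac{1+\alpha}{2},\frac{2-\alpha}{2}\right)-2^\alpha}{\alpha 2^\alpha}.$$ Then for every $u\in C_c(a,b)$, $$ \begin{aligned} \frac12\int_a^b\!\int_a^b\frac{(u(x)-u(y))^2}{|x-y|^{1+\alpha}}\,dx\,dy \ge{}&\kappa_{1,\alpha}\int_a^bu^2(x)\left(\frac1{x-a}+\frac1{b-x}\right)^\alpha dx\\ &+\frac{4-2^{3-\alpha}}{\alpha(b-a)}\int_a^bu^2(x)\left(\frac1{x-a}+\frac1{b-x}\right)^{\alpha-1}dx. \end{aligned} $$ Moreover, the constant $\kappa_{1,\alpha}$ in this inequality may not be replaced by a bigger constant: for every $c>\kappa_{1,\alpha}$ the inequality with $\kappa_{1,\alpha}$ replaced by $c$ (and the last term unchanged) fails for some $u\in C_c(a,b)$.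
   Context: $C_c(a,b)$ denotes the class of all continuous functions $u\colon(a,b)\to\mathbb{R}$ with compact support in $(a,b)$. $B$ is the Euler beta function. The double integral takes values in $[0,\infty]$. *)

theory Defs
  imports "HOL-Analysis.Analysis"
begin

(* A function on (a,b) is represented by a total function; its values outside (a,b) are
   unconstrained and never used. *)
definition Cc :: "real \<Rightarrow> real \<Rightarrow> (real \<Rightarrow> real) set" where
  "Cc a b = {u. continuous_on {a<..<b} u \<and>
                compact (closure {x \<in> {a<..<b}. u x \<noteq> 0}) \<and>
                closure {x \<in> {a<..<b}. u x \<noteq> 0} \<subseteq> {a<..<b}}"

definition kappa1 :: "real \<Rightarrow> real" where
  "kappa1 \<alpha> = (Beta ((1 + \<alpha>) / 2) ((2 - \<alpha>) / 2) - 2 powr \<alpha>) / (\<alpha> * 2 powr \<alpha>)"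

(* The integrand is 0 on the null set x = y, because division by zero yields 0. *)
definition energy :: "real \<Rightarrow> real \<Rightarrow> real \<Rightarrow> (real \<Rightarrow> real) \<Rightarrow> ennreal" where
  "energy \<alpha> a b u =
     ennreal (1 / 2) *
     (\<integral>\<^sup>+x\<in>{a<..<b}. (\<integral>\<^sup>+y\<in>{a<..<b}.
        ennreal ((u x - u y)\<^sup>2 / \<bar>x - y\<bar> powr (1 + \<alpha>)) \<partial>lborel) \<partial>lborel)"

(* For u in Cc a b the integrand is bounded with compact support in (a,b), so the integral
   exists and is finite. *)
definition weighted_integral :: "real \<Rightarrow> real \<Rightarrow> real \<Rightarrow> (real \<Rightarrow> real) \<Rightarrow> real" where
  "weighted_integral s a b u =
     (LBINT x:{a<..<b}. (u x)\<^sup>2 * (1 / (x - a) + 1 / (b - x)) powr s)"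

(* The right-hand side is a finite real number. As the energy is nonnegative, embedding the
   right-hand side by ennreal, which sends negative reals to 0, does not change the inequality. *)
definition hardy_inequality ::
  "real \<Rightarrow> real \<Rightarrow> real \<Rightarrow> real \<Rightarrow> (real \<Rightarrow> real) \<Rightarrow> bool" where
  "hardy_inequality c \<alpha> a b u \<longleftrightarrow>
     energy \<alpha> a b u \<ge>
       ennreal (c * weighted_integral \<alpha> a b u
         + (4 - 2 powr (3 - \<alpha>)) / (\<alpha> * (b - a)) * weighted_integral (\<alpha> - 1) a b u)"

end

theory Submission
  imports Defs
begin

text \<open>The inequality becomes transparent in the coordinate \<open>\<xi>\<close> given by
\<open>x = (a + b) / 2 + r tanh \<xi>\<close> with \<open>r = (b - a) / 2\<close>, which maps the line onto \<open>(a, b)\<close>. Let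
\<open>H \<xi> = cosh \<xi> powr (\<alpha> - 1)\<close> and \<open>K s = \<bar>sinh s\<bar> powr (- 1 - \<alpha>)\<close>, and write \<open>u = v / H\<close>. The function
\<open>1 / H\<close> is the ground state: on \<open>(-1, 1)\<close> it is \<open>(1 - x\<^sup>2) powr ((\<alpha> - 1) / 2)\<close>. The kernel of the
energy becomes \<open>r powr (1 - \<alpha>) * H \<xi> * H \<eta> * K (\<eta> - \<xi>)\<close> (\<open>kernel_in_chart\<close>), and both weighted integrals
become integrals of \<open>v\<^sup>2\<close>, with weight constant for the exponent \<open>\<alpha>\<close> and proportional to
\<open>1 - (tanh \<xi>)\<^sup>2\<close> for the exponent \<open>\<alpha> - 1\<close> (\<open>hardy_right_side_in_chart\<close>).

Expanding \<open>(v \<xi> / H \<xi> - v \<eta> / H \<eta>)\<^sup>2 * H \<xi> * H \<eta>\<close> and integrating first over \<open>\<xi>\<close> with \<open>s = \<eta> - \<xi>\<close> held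
fixed, the translation invariance of Lebesgue measure gives the sum of the integrals of
\<open>(v \<xi> - v (\<xi> + s))\<^sup>2\<close> and of \<open>(v \<xi>)\<^sup>2 * G \<xi> s\<close>, where
\<open>G \<xi> s = (H (\<xi> + s) + H (\<xi> - s)) / H \<xi> - 2\<close>. Since \<open>G\<close> is nonnegative, no principal value is needed: after
multiplication with \<open>K s\<close> both terms are integrals of nonnegative functions
(\<open>ground_state_identity\<close>). With \<open>t = tanh s\<close> and \<open>x = tanh \<xi>\<close> the integral of \<open>G \<xi> s * K s\<close> over \<open>s\<close> reduces,
up to an elementary primitive, to a Beta integral, and it equals twice
\<open>V x = (B - (1 + x) powr \<alpha> - (1 - x) powr \<alpha>) / \<alpha>\<close>, where \<open>B\<close> is the value of the Beta function in \<open>kappa1 \<alpha>\<close>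
(\<open>has_integral_potential\<close>). Hence
\<open>energy = r powr (1 - \<alpha>) * (A / 2 + W)\<close>, where \<open>A\<close> is the integral of
\<open>K s * (v \<xi> - v (\<xi> + s))\<^sup>2\<close> over the plane and \<open>W\<close> is the integral of \<open>V (tanh \<xi>) * (v \<xi>)\<^sup>2\<close> over the line
(\<open>energy_decomposition\<close>).

For the inequality the term \<open>A\<close> is discarded. The even function \<open>(1 + x) powr \<alpha> + (1 - x) powr \<alpha>\<close> lies
below its chord as a function of \<open>x\<^sup>2\<close> (\<open>even_powr_sum_le_chord\<close>), which bounds \<open>V\<close> from below by exactly
the weights on the right-hand side. For the sharpness, \<open>V\<close> exceeds its limit at the ends of the
interval, \<open>2 powr \<alpha> * kappa1 \<alpha>\<close>, only by a multiple of the integrable function \<open>1 - (tanh \<xi>)\<^sup>2\<close>. If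
\<open>v\<close> is a tent of height 1 and width \<open>2 N\<close>, then \<open>A\<close> is of order \<open>1 / N\<close>, because \<open>s\<^sup>2 * K s\<close> is
integrable, whereas the integral of \<open>v\<^sup>2\<close> is of order \<open>N\<close>; so a larger constant fails for large \<open>N\<close>.\<close>

section \<open>Inequalities for powers\<close>

text \<open>Convexity of the power on the open half-line gives this for positive \<open>z\<close>. The boundary point \<open>z = 0\<close> is
included because \<open>1 - y\<close> vanishes at \<open>y = 1\<close> in \<open>even_powr_sum_ge_2\<close>.\<close>

lemma powr_ge_tangent:
  fixes p c z :: real
  assumes p: "1 \<le> p" and c: "0 < c" and z: "0 \<le> z"
  shows "c powr p + p * c powr (p - 1) * (z - c) \<le> z powr p"
proof (cases "z = 0")
  case True
  have "c powr (p - 1) * c = c powr p"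
    using c powr_mult_base[of c "p - 1"] by (simp add: mult.commute)
  moreover have "1 * c powr p \<le> p * c powr p"
    using p by (intro mult_right_mono) auto
  ultimately show ?thesis using True by (simp add: algebra_simps)
next
  case False
  have "z powr p - c powr p \<ge> (p * c powr (p - 1)) * (z - c)"
  proof (rule convex_on_imp_above_tangent)
    show "convex_on {0<..} (\<lambda>x. x powr p)" by (rule powr_convex[OF p])
    show "((\<lambda>x. x powr p) has_real_derivative p * c powr (p - 1)) (at c within {0<..})"
      using c by (intro has_field_derivative_at_within[OF has_real_derivative_powr])
  qed (use False c z in \<open>auto simp: interior_open\<close>)
  then show ?thesis by simp
qed

lemma even_powr_sum_ge_2:
  fixes p y :: real
  assumes "1 \<le> p" "\<bar>y\<bar> \<le> 1"
  shows "2 \<le> (1 + y) powr p + (1 - y) powr p"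
  using powr_ge_tangent[of p 1 "1 + y"] powr_ge_tangent[of p 1 "1 - y"] assms by (simp add: abs_le_iff)

text \<open>The odd function \<open>s \<mapsto> (1 + s) powr q - (1 - s) powr q\<close> vanishes at 0 and is convex on \<open>[0, 1)\<close>, since
its derivative is increasing there; hence its quotient by \<open>s\<close> is increasing.\<close>

lemma odd_powr_difference_star_shaped:
  fixes q s t :: real
  assumes q: "0 < q" "q < 1" and st: "0 \<le> s" "s \<le> t" "0 < t" "t < 1"
  shows "(1 + s) powr q - (1 - s) powr q \<le> s / t * ((1 + t) powr q - (1 - t) powr q)"
proof -
  let ?h = "\<lambda>s. (1 + s) powr q - (1 - s) powr q"
  let ?k = "\<lambda>s. (1 + s) powr (q - 1) + (1 - s) powr (q - 1)"
  have k_mono: "?k x \<le> ?k y" if xy: "0 \<le> x" "x \<le> y" "y < 1" for x y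
  proof (rule DERIV_nonneg_imp_nondecreasing[OF xy(2)])
    fix w assume w: "x \<le> w" "w \<le> y"
    have "(?k has_real_derivative (q - 1) * ((1 + w) powr (q - 2) - (1 - w) powr (q - 2))) (at w)"
      using w xy by (auto intro!: derivative_eq_intros DERIV_fun_powr simp: algebra_simps)
    moreover have "0 \<le> (q - 1) * ((1 + w) powr (q - 2) - (1 - w) powr (q - 2))"
      using w xy q by (intro mult_nonpos_nonpos) (auto intro!: powr_mono2')
    ultimately show "\<exists>d. (?k has_real_derivative d) (at w) \<and> 0 \<le> d" by blast
  qed
  have "convex_on {0..<1} ?h"
  proof (rule convex_on_realI)
    show "connected {0..<1::real}" by simp
    show "(?h has_real_derivative q * ?k x) (at x)" if "x \<in> {0..<1}" for x
      using that by (auto intro!: derivative_eq_intros DERIV_fun_powr simp: algebra_simps)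
    show "q * ?k x \<le> q * ?k y" if "x \<in> {0..<1}" "y \<in> {0..<1}" "x \<le> y" for x y
      using that q by (intro mult_left_mono k_mono) auto
  qed
  from convex_onD[OF this, of "s / t" 0 t] show ?thesis
    using st by simp
qed

text \<open>As a function of \<open>y\<^sup>2\<close> the left-hand side is convex, and the right-hand side is its chord between the
values 2 at \<open>y = 0\<close> and \<open>2 powr p\<close> at \<open>y = 1\<close>. Convexity enters through
\<open>odd_powr_difference_star_shaped\<close>: the difference \<open>D\<close> of the two sides vanishes at 0 and 1, so at a
negative value of \<open>D\<close> its derivative would have to be negative somewhere before and positive somewhere
after, while \<open>D' s / s\<close> is decreasing.\<close>

lemma even_powr_sum_le_chord:
  fixes p y :: real
  assumes p: "1 < p" "p < 2" and y: "\<bar>y\<bar> \<le> 1"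
  shows "(1 + y) powr p + (1 - y) powr p \<le> 2 + (2 powr p - 2) * y\<^sup>2"
proof -
  let ?f = "\<lambda>y. (1 + y) powr p + (1 - y) powr p"
  let ?h = "\<lambda>s. (1 + s) powr (p - 1) - (1 - s) powr (p - 1)"
  define D where "D s = 2 + (2 powr p - 2) * s\<^sup>2 - ?f s" for s
  define D' where "D' s = (2 powr p - 2) * (2 * s) - p * ?h s" for s
  have D_deriv: "(D has_real_derivative D' s) (at s)" if "0 < s" "s < 1" for s
    unfolding D_def D'_def using that
    by (auto intro!: derivative_eq_intros DERIV_fun_powr simp: algebra_simps)
  have D_cont: "continuous_on {0..1} D"
    unfolding D_def using p by (intro continuous_intros continuous_on_powr') auto
  have D0: "D 0 = 0" and D1: "D 1 = 0" unfolding D_def by auto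
  \<comment> \<open>Mean values on both sides of a point where \<open>D\<close> is negative.\<close>
  have nonneg: "0 \<le> D s" if s: "0 < s" "s < 1" for s
  proof (rule ccontr)
    assume neg: "\<not> 0 \<le> D s"
    obtain u where u: "0 < u" "u < s" "D s - D 0 = D' u * (s - 0)"
      by (rule mvt[OF s(1), of D "\<lambda>x. (*) (D' x)"])
         (use s in \<open>auto intro!: continuous_on_subset[OF D_cont]
            simp flip: has_field_derivative_def intro: D_deriv\<close>)
    obtain w where w: "s < w" "w < 1" "D 1 - D s = D' w * (1 - s)"
      by (rule mvt[OF s(2), of D "\<lambda>x. (*) (D' x)"])
         (use s in \<open>auto intro!: continuous_on_subset[OF D_cont]
            simp flip: has_field_derivative_def intro: D_deriv\<close>)
    have "D' u < 0" using u neg D0 by (smt (verit) mult_nonneg_nonneg)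
    have "0 < D' w" using w neg D1 by (smt (verit) mult_nonneg_nonpos2)
    have "?h u \<le> u / w * ?h w"
      by (rule odd_powr_difference_star_shaped) (use p u w in auto)
    then have "p * ?h u \<le> p * (u / w * ?h w)" using p by (intro mult_left_mono) auto
    then have "u / w * D' w \<le> D' u"
      unfolding D'_def using u w by (simp add: field_simps)
    moreover have "0 < u / w * D' w" using u w \<open>0 < D' w\<close> by simp
    ultimately show False using \<open>D' u < 0\<close> by simp
  qed
  have "0 \<le> D \<bar>y\<bar>"
    using nonneg[of "\<bar>y\<bar>"] D0 D1 y by (cases "\<bar>y\<bar> = 0 \<or> \<bar>y\<bar> = 1") auto
  then show ?thesis unfolding D_def by (cases "0 \<le> y") (auto simp: add.commute)
qed

text \<open>The arithmetic-geometric mean inequality together with \<open>1 - x\<^sup>2 t\<^sup>2 \<ge> 1 - t\<^sup>2\<close>. This is the nonnegativity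
of the second difference of the weight, in the variables \<open>x = tanh \<xi>\<close> and \<open>t = tanh s\<close>.\<close>

lemma geometric_mean_bound:
  fixes q x t :: real
  assumes q: "0 < q" and x: "\<bar>x\<bar> \<le> 1" and t: "\<bar>t\<bar> \<le> 1"
  shows "2 * (1 - t\<^sup>2) powr (q / 2) \<le> (1 + x * t) powr q + (1 - x * t) powr q"
proof -
  have xt: "\<bar>x * t\<bar> \<le> 1" using x t by (simp add: abs_mult mult_le_one)
  let ?A = "(1 + x * t) powr (q / 2)" and ?B = "(1 - x * t) powr (q / 2)"
  have sq: "?A\<^sup>2 = (1 + x * t) powr q" "?B\<^sup>2 = (1 - x * t) powr q"
    by (simp_all add: power2_eq_square flip: powr_add)
  have "(1 - t\<^sup>2) powr (q / 2) \<le> (1 - (x * t)\<^sup>2) powr (q / 2)"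
  proof (rule powr_mono2)
    show "1 - t\<^sup>2 \<le> 1 - (x * t)\<^sup>2"
      using x by (simp add: power_mult_distrib mult_left_le_one_le abs_square_le_1)
  qed (use q t in \<open>auto simp: abs_square_le_1\<close>)
  also have "\<dots> = ?A * ?B"
    by (simp add: powr_mult[symmetric] power2_eq_square algebra_simps)
  finally have "2 * (1 - t\<^sup>2) powr (q / 2) \<le> 2 * ?A * ?B" by simp
  also have "\<dots> \<le> ?A\<^sup>2 + ?B\<^sup>2" by (rule sum_squares_bound)
  finally show ?thesis by (simp add: sq)
qed

lemma Beta_real_nonneg:
  fixes a b :: real
  assumes "0 < a" "0 < b"
  shows "0 \<le> Beta a b"
  by (rule has_integral_nonneg[OF has_integral_Beta_real[OF assms]]) auto

section \<open>The ground state potential\<close>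

text \<open>On \<open>(-1, 1)\<close> let \<open>w x = (1 - x\<^sup>2) powr ((\<alpha> - 1) / 2)\<close>. The principal value over \<open>y\<close> in \<open>(-1, 1)\<close> of the
integral of \<open>(w x - w y) / \<bar>x - y\<bar> powr (1 + \<alpha>)\<close> is
\<open>(1 - x\<^sup>2) powr (- \<alpha>) * ground_potential \<alpha> x * w x\<close>; so this is the potential whose ground state is \<open>w\<close>,
with the singular factor \<open>(1 - x\<^sup>2) powr (- \<alpha>)\<close> removed.\<close>

definition ground_potential :: "real \<Rightarrow> real \<Rightarrow> real" where
  "ground_potential \<alpha> x =
     (Beta ((1 + \<alpha>) / 2) ((2 - \<alpha>) / 2) - ((1 + x) powr \<alpha> + (1 - x) powr \<alpha>)) / \<alpha>"

text \<open>Euler's Beta integral after the substitution of \<open>t\<^sup>2\<close> for the variable.\<close>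

lemma has_integral_Beta_squared:
  fixes a b :: real
  assumes a: "0 < a" and b: "0 < b"
  shows "((\<lambda>t. t powr (2 * a - 1) * (1 - t\<^sup>2) powr (b - 1)) has_integral Beta a b / 2) {0..1}"
proof -
  let ?f = "\<lambda>s. s powr (a - 1) * (1 - s) powr (b - 1)"
  let ?g = "\<lambda>t::real. t\<^sup>2"
  have img: "?g ` {0..1} = {0..1}"
  proof (intro equalityI subsetI)
    fix s :: real assume "s \<in> {0..1}"
    then show "s \<in> ?g ` {0..1}" by (intro image_eqI[of _ _ "sqrt s"]) auto
  qed (auto simp: power_le_one)
  have I: "(?f has_integral Beta a b) {0..1}" by (rule has_integral_Beta_real[OF a b])
  have "?f absolutely_integrable_on ?g ` {0..1}"
    unfolding img by (rule nonnegative_absolutely_integrable_1) (use I in \<open>auto simp: has_integral_integrable\<close>)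
  moreover have "integral (?g ` {0..1}) ?f = Beta a b"
    unfolding img using I by (rule integral_unique)
  ultimately have "(\<lambda>t. \<bar>2 * t\<bar> * ?f (?g t)) absolutely_integrable_on {0..1}
      \<and> integral {0..1} (\<lambda>t. \<bar>2 * t\<bar> * ?f (?g t)) = Beta a b"
    by (subst has_absolute_integral_change_of_variables_1')
       (auto intro!: derivative_eq_intros inj_onI simp: power2_eq_iff)
  then have "((\<lambda>t. \<bar>2 * t\<bar> * ?f (?g t)) has_integral Beta a b) {0..1}"
    by (simp add: has_integral_iff set_lebesgue_integral_eq_integral(1))
  then have "((\<lambda>t. 1/2 * (\<bar>2 * t\<bar> * ?f (?g t))) has_integral 1/2 * Beta a b) {0..1}"
    by (rule has_integral_mult_right)
  moreover have "1/2 * (\<bar>2 * t\<bar> * ?f (?g t)) = t powr (2 * a - 1) * (1 - t\<^sup>2) powr (b - 1)"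
    if "t \<in> {0..1}" for t
  proof -
    \<comment> \<open>At \<open>t = 0\<close> both sides are 0, because \<open>0 powr z = 0\<close> for every \<open>z\<close>.\<close>
    have "t * (t\<^sup>2) powr (a - 1) = t powr (2 * a - 1)"
      using that powr_mult_base[of t "2 * (a - 1)"]
      by (simp add: powr_powr algebra_simps flip: powr_numeral)
    then show ?thesis using that by (simp add: mult.assoc[symmetric])
  qed
  ultimately show ?thesis by (subst has_integral_cong[symmetric]) auto
qed

text \<open>The integrand differs by the multiple \<open>4 p / \<alpha>\<close>, \<open>p = (\<alpha> - 1) / 2\<close>, of the Beta integrand
\<open>t powr (1 - \<alpha>) * (1 - t\<^sup>2) powr (p - 1)\<close> from the derivative of
\<open>F t = - (1 / \<alpha>) * t powr (- \<alpha>) * Q t\<close>, where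
\<open>Q t = (1 + x t) powr \<alpha> + (1 - x t) powr \<alpha> - 2 (1 - t\<^sup>2) powr p\<close>. As \<open>0 \<le> Q t \<le> 2 powr \<alpha> * t\<^sup>2\<close> and
\<open>\<alpha> < 2\<close>, the primitive tends to 0 at \<open>t = 0\<close>, and \<open>F 1\<close> produces the two powers of \<open>1 + x\<close> and \<open>1 - x\<close>.\<close>

lemma has_integral_potential:
  fixes \<alpha> x :: real
  assumes \<alpha>: "1 < \<alpha>" "\<alpha> < 2" and x: "\<bar>x\<bar> < 1"
  shows "((\<lambda>t. ((1 + x * t) powr (\<alpha> - 1) + (1 - x * t) powr (\<alpha> - 1)
                - 2 * (1 - t\<^sup>2) powr ((\<alpha> - 1) / 2)) * t powr (- 1 - \<alpha>))
          has_integral ground_potential \<alpha> x) {0..1}"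
    (is "(?\<Phi> has_integral ?I) _")
proof -
  define p where "p = (\<alpha> - 1) / 2"
  have p: "0 < p" "p < 1" using \<alpha> by (auto simp: p_def)
  define Q where "Q t = (1 + x * t) powr \<alpha> + (1 - x * t) powr \<alpha> - 2 * (1 - t\<^sup>2) powr p" for t
  define F where "F t = - (1 / \<alpha>) * (t powr (- \<alpha>) * Q t)" for t
  define R where "R t = t powr (1 - \<alpha>) * (1 - t\<^sup>2) powr (p - 1)" for t :: real
  have xt: "\<bar>x * t\<bar> < 1" if "t \<in> {0..1}" for t
    using that x mult_left_mono[of t 1 "\<bar>x\<bar>"] by (auto simp: abs_mult)
  have F_deriv: "(F has_real_derivative ?\<Phi> t - 4 * p / \<alpha> * R t) (at t)" if t: "t \<in> {0<..<1}" for t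
  proof -
    have pos: "0 < 1 + x * t" "0 < 1 - x * t" "0 < 1 - t\<^sup>2" "0 < t"
      using xt[of t] t by (auto simp: abs_less_iff abs_square_less_1)
    have Q': "(Q has_real_derivative
        \<alpha> * (1 + x * t) powr (\<alpha> - 1) * x - \<alpha> * (1 - x * t) powr (\<alpha> - 1) * x
        + 4 * p * t * (1 - t\<^sup>2) powr (p - 1)) (at t)"
      unfolding Q_def using pos by (auto intro!: derivative_eq_intros DERIV_fun_powr simp: algebra_simps)
    have F': "(F has_real_derivative
        - (1 / \<alpha>) * (- \<alpha> * t powr (- \<alpha> - 1) * Q t +
        (\<alpha> * (1 + x * t) powr (\<alpha> - 1) * x - \<alpha> * (1 - x * t) powr (\<alpha> - 1) * x
        + 4 * p * t * (1 - t\<^sup>2) powr (p - 1)) * t powr (- \<alpha>))) (at t)"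
      unfolding F_def using pos(4) by (intro DERIV_cmult DERIV_mult Q' has_real_derivative_powr)
    \<comment> \<open>All powers are reduced to these four, so that the claim becomes an identity of rational
      functions.\<close>
    define T A B E where "T = t powr (- 1 - \<alpha>)" and "A = (1 + x * t) powr (\<alpha> - 1)"
      and "B = (1 - x * t) powr (\<alpha> - 1)" and "E = (1 - t\<^sup>2) powr (p - 1)"
    have "- \<alpha> - 1 = - 1 - \<alpha>" by simp
    then have T: "t powr (- \<alpha> - 1) = T" unfolding T_def by (simp only:)
    have e: "t powr (- \<alpha>) = t * T" "t powr (1 - \<alpha>) = t\<^sup>2 * T"
      "(1 + x * t) powr \<alpha> = (1 + x * t) * A" "(1 - x * t) powr \<alpha> = (1 - x * t) * B"
      "(1 - t\<^sup>2) powr p = (1 - t\<^sup>2) * E"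
      using pos powr_mult_base[of t "- 1 - \<alpha>"] powr_mult_base[of t "- \<alpha>"]
        powr_mult_base[of "1 + x * t" "\<alpha> - 1"] powr_mult_base[of "1 - x * t" "\<alpha> - 1"]
        powr_mult_base[of "1 - t\<^sup>2" "p - 1"]
      by (auto simp: T_def A_def B_def E_def power2_eq_square mult.assoc)
    have "- (1 / \<alpha>) * (- \<alpha> * t powr (- \<alpha> - 1) * Q t +
        (\<alpha> * (1 + x * t) powr (\<alpha> - 1) * x - \<alpha> * (1 - x * t) powr (\<alpha> - 1) * x
        + 4 * p * t * (1 - t\<^sup>2) powr (p - 1)) * t powr (- \<alpha>)) = ?\<Phi> t - 4 * p / \<alpha> * R t"
      unfolding Q_def R_def p_def[symmetric] e T A_def[symmetric] B_def[symmetric]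
        E_def[symmetric] T_def[symmetric]
      using \<alpha> by (simp add: field_simps power2_eq_square)
    with F' show ?thesis by simp
  qed
  have Q_bounds: "0 \<le> Q t \<and> Q t \<le> 2 powr \<alpha> * t\<^sup>2" if t: "t \<in> {0..1}" for t
  proof -
    have t2: "t\<^sup>2 \<le> 1" using t by (simp add: power_le_one)
    have "(1 - t\<^sup>2) powr p \<le> 1" using t2 p by (intro powr_le1) auto
    moreover have "1 - t\<^sup>2 \<le> (1 - t\<^sup>2) powr p"
      using powr_mono'[of p 1 "1 - t\<^sup>2"] p t2 by simp
    moreover have "2 \<le> (1 + x * t) powr \<alpha> + (1 - x * t) powr \<alpha>"
      using even_powr_sum_ge_2[of \<alpha> "x * t"] \<alpha> xt[OF t] by simp
    moreover have "(1 + x * t) powr \<alpha> + (1 - x * t) powr \<alpha> \<le> 2 + (2 powr \<alpha> - 2) * (x * t)\<^sup>2"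
      using even_powr_sum_le_chord[of \<alpha> "x * t"] \<alpha> xt[OF t] by simp
    moreover have "(2 powr \<alpha> - 2) * (x * t)\<^sup>2 \<le> (2 powr \<alpha> - 2) * t\<^sup>2"
    proof (rule mult_left_mono)
      show "(x * t)\<^sup>2 \<le> t\<^sup>2"
        using x by (simp add: power_mult_distrib mult_left_le_one_le abs_square_le_1)
      show "0 \<le> 2 powr \<alpha> - 2" using powr_mono[of 1 \<alpha> 2] \<alpha> by simp
    qed
    ultimately show ?thesis by (simp add: Q_def algebra_simps)
  qed
  have "continuous_on {0..1} F"
  proof -
    have "continuous (at t within {0..1}) F" if t: "t \<in> {0..1}" for t
    proof (cases "t = 0")
      case False
      then have "0 < 1 + x * t" "0 < 1 - x * t" using xt[OF t] by (auto simp: abs_less_iff)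
      with False t show ?thesis
        unfolding F_def Q_def continuous_within
        by (intro tendsto_intros) (use p t in \<open>auto simp: eventually_at_filter power_le_one\<close>)
    next
      case True
      have "((\<lambda>s. 2 powr \<alpha> / \<alpha> * s powr (2 - \<alpha>)) \<longlongrightarrow> 2 powr \<alpha> / \<alpha> * 0 powr (2 - \<alpha>)) (at 0 within {0..1})"
        using \<alpha> by (intro tendsto_intros) (auto simp: eventually_at_filter)
      then have "((\<lambda>s. 2 powr \<alpha> / \<alpha> * s powr (2 - \<alpha>)) \<longlongrightarrow> 0) (at 0 within {0..1})" by simp
      then have "(F \<longlongrightarrow> 0) (at 0 within {0..1})"
      proof (rule Lim_null_comparison[rotated])
        have "norm (F s) \<le> 2 powr \<alpha> / \<alpha> * s powr (2 - \<alpha>)" if s: "s \<in> {0..1}" for s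
        proof -
          have "norm (F s) = 1 / \<alpha> * (s powr (- \<alpha>) * Q s)"
            using \<alpha> Q_bounds[OF s] by (simp add: F_def abs_mult)
          also have "\<dots> \<le> 1 / \<alpha> * (s powr (- \<alpha>) * (2 powr \<alpha> * s\<^sup>2))"
            using \<alpha> Q_bounds[OF s] by (intro mult_left_mono) auto
          also have "s powr (- \<alpha>) * (2 powr \<alpha> * s\<^sup>2) = 2 powr \<alpha> * s powr (2 - \<alpha>)"
            using s powr_add[of s "- \<alpha>" 2] by (simp add: add.commute)
          finally show ?thesis by simp
        qed
        then show "\<forall>\<^sub>F s in at 0 within {0..1}. norm (F s) \<le> 2 powr \<alpha> / \<alpha> * s powr (2 - \<alpha>)"
          by (simp add: eventually_at_filter)
      qed
      then show ?thesis using True by (simp add: continuous_within F_def)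
    qed
    then show ?thesis by (simp add: continuous_on_eq_continuous_within)
  qed
  then have "((\<lambda>t. ?\<Phi> t - 4 * p / \<alpha> * R t) has_integral F 1 - F 0) {0..1}"
    by (intro fundamental_theorem_of_calculus_interior
          has_real_derivative_iff_has_vector_derivative[THEN iffD1] F_deriv) auto
  moreover have "((\<lambda>t. 4 * p / \<alpha> * R t) has_integral 4 * p / \<alpha> * (Beta (1 - \<alpha> / 2) p / 2)) {0..1}"
    using has_integral_Beta_squared[of "1 - \<alpha> / 2" p] \<alpha> p unfolding R_def
    by (intro has_integral_mult_right) simp
  ultimately have "((\<lambda>t. (?\<Phi> t - 4 * p / \<alpha> * R t) + 4 * p / \<alpha> * R t)
      has_integral (F 1 - F 0) + 4 * p / \<alpha> * (Beta (1 - \<alpha> / 2) p / 2)) {0..1}"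
    by (rule has_integral_add)
  \<comment> \<open>\<open>F 0 = 0\<close> because \<open>0 powr z = 0\<close>; this is the correct limit, by the continuity of \<open>F\<close>.\<close>
  moreover have "(F 1 - F 0) + 4 * p / \<alpha> * (Beta (1 - \<alpha> / 2) p / 2) = ?I"
  proof -
    have "p \<notin> \<int>\<^sub>\<le>\<^sub>0" using p by (auto elim: nonpos_Ints_cases)
    then have "(p + (1 - \<alpha> / 2)) * Beta (p + 1) (1 - \<alpha> / 2) = p * Beta p (1 - \<alpha> / 2)"
      by (rule Beta_plus1_left)
    moreover have "p + (1 - \<alpha> / 2) = 1 / 2" "p + 1 = (1 + \<alpha>) / 2"
      by (simp_all add: p_def field_simps)
    ultimately have "1 / 2 * Beta ((1 + \<alpha>) / 2) (1 - \<alpha> / 2) = p * Beta p (1 - \<alpha> / 2)"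
      by (simp only:)
    moreover have "Beta ((1 + \<alpha>) / 2) ((2 - \<alpha>) / 2) = Beta ((1 + \<alpha>) / 2) (1 - \<alpha> / 2)"
      by (simp add: diff_divide_distrib)
    ultimately have "Beta ((1 + \<alpha>) / 2) ((2 - \<alpha>) / 2) = 2 * p * Beta (1 - \<alpha> / 2) p"
      using Beta_commute[of p "1 - \<alpha> / 2"] by simp
    then show ?thesis using \<alpha> by (simp add: ground_potential_def F_def Q_def diff_divide_distrib)
  qed
  ultimately show ?thesis by simp
qed

lemma ground_potential_nonneg:
  assumes \<alpha>: "1 < \<alpha>" "\<alpha> < 2" and x: "\<bar>x\<bar> < 1"
  shows "0 \<le> ground_potential \<alpha> x"
  using has_integral_potential[OF \<alpha> x]
  by (rule has_integral_nonneg)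
     (use geometric_mean_bound[of "\<alpha> - 1" x] \<alpha> x in \<open>auto intro!: mult_nonneg_nonneg\<close>)

text \<open>The chord bound for \<open>(1 + x) powr \<alpha> + (1 - x) powr \<alpha>\<close>; the remainder term of the Hardy inequality has
exactly the coefficient of \<open>1 - x\<^sup>2\<close> found here.\<close>

lemma ground_potential_lower:
  assumes \<alpha>: "1 < \<alpha>" "\<alpha> < 2" and x: "\<bar>x\<bar> < 1"
  shows "kappa1 \<alpha> * 2 powr \<alpha> + (2 powr \<alpha> - 2) / \<alpha> * (1 - x\<^sup>2) \<le> ground_potential \<alpha> x"
proof -
  have "kappa1 \<alpha> * 2 powr \<alpha> = (Beta ((1 + \<alpha>) / 2) ((2 - \<alpha>) / 2) - 2 powr \<alpha>) / \<alpha>"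
    by (simp add: kappa1_def)
  moreover have "(2 powr \<alpha> - 2) * (1 - x\<^sup>2) / \<alpha> \<le> (2 powr \<alpha> - ((1 + x) powr \<alpha> + (1 - x) powr \<alpha>)) / \<alpha>"
    using even_powr_sum_le_chord[of \<alpha> x] \<alpha> x by (intro divide_right_mono) (auto simp: algebra_simps)
  moreover have "ground_potential \<alpha> x = (Beta ((1 + \<alpha>) / 2) ((2 - \<alpha>) / 2) - 2 powr \<alpha>) / \<alpha>
      + (2 powr \<alpha> - ((1 + x) powr \<alpha> + (1 - x) powr \<alpha>)) / \<alpha>"
    by (simp add: ground_potential_def diff_divide_distrib)
  ultimately show ?thesis by simp
qed

text \<open>The tangent to the power at 2 bounds \<open>(1 + \<bar>x\<bar>) powr \<alpha>\<close> from below, so the potential exceeds its value at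
the ends of the interval by at most a multiple of the distance to the nearer end.\<close>

lemma ground_potential_upper:
  assumes \<alpha>: "1 < \<alpha>" "\<alpha> < 2" and x: "\<bar>x\<bar> < 1"
  shows "ground_potential \<alpha> x \<le> kappa1 \<alpha> * 2 powr \<alpha> + 2 powr (\<alpha> - 1) * (1 - x\<^sup>2)"
proof -
  have k: "kappa1 \<alpha> * 2 powr \<alpha> = (Beta ((1 + \<alpha>) / 2) ((2 - \<alpha>) / 2) - 2 powr \<alpha>) / \<alpha>"
    by (simp add: kappa1_def)
  have "2 powr \<alpha> + \<alpha> * 2 powr (\<alpha> - 1) * ((1 + \<bar>x\<bar>) - 2) \<le> (1 + \<bar>x\<bar>) powr \<alpha>"
    by (rule powr_ge_tangent) (use \<alpha> in auto)
  also have "\<dots> \<le> (1 + x) powr \<alpha> + (1 - x) powr \<alpha>"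
    by (cases "0 \<le> x") auto
  finally have "2 powr \<alpha> - ((1 + x) powr \<alpha> + (1 - x) powr \<alpha>) \<le> \<alpha> * 2 powr (\<alpha> - 1) * (1 - \<bar>x\<bar>)"
    by (simp add: algebra_simps)
  also have "\<dots> \<le> \<alpha> * 2 powr (\<alpha> - 1) * (1 - x\<^sup>2)"
  proof (rule mult_left_mono)
    have "\<bar>x\<bar> * \<bar>x\<bar> \<le> \<bar>x\<bar>" using x by (intro mult_left_le_one_le) auto
    then show "1 - \<bar>x\<bar> \<le> 1 - x\<^sup>2" by (simp add: power2_eq_square)
  qed (use \<alpha> in auto)
  finally have "(2 powr \<alpha> - ((1 + x) powr \<alpha> + (1 - x) powr \<alpha>)) / \<alpha> \<le> (\<alpha> * 2 powr (\<alpha> - 1) * (1 - x\<^sup>2)) / \<alpha>"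
    using \<alpha> by (intro divide_right_mono) auto
  then show ?thesis unfolding k ground_potential_def using \<alpha> by (simp add: diff_divide_distrib)
qed

text \<open>In \<open>ground_potential_upper\<close> a nonnegative potential is bounded by an expression that tends to
\<open>kappa1 \<alpha> * 2 powr \<alpha>\<close> at the end of the interval.\<close>

lemma kappa1_nonneg:
  assumes \<alpha>: "1 < \<alpha>" "\<alpha> < 2"
  shows "0 \<le> kappa1 \<alpha>"
proof -
  have "((\<lambda>x. kappa1 \<alpha> * 2 powr \<alpha> + 2 powr (\<alpha> - 1) * (1 - x\<^sup>2))
      \<longlongrightarrow> kappa1 \<alpha> * 2 powr \<alpha> + 2 powr (\<alpha> - 1) * (1 - 1\<^sup>2)) (at_left (1::real))"
    by (intro tendsto_intros)
  moreover have "\<forall>\<^sub>F x in at_left (1::real).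
      0 \<le> kappa1 \<alpha> * 2 powr \<alpha> + 2 powr (\<alpha> - 1) * (1 - x\<^sup>2)"
    using eventually_at_left_real[of 0 1]
  proof (rule eventually_mono)
    fix x :: real assume "x \<in> {0<..<1}"
    then show "0 \<le> kappa1 \<alpha> * 2 powr \<alpha> + 2 powr (\<alpha> - 1) * (1 - x\<^sup>2)"
      using ground_potential_nonneg[OF \<alpha>, of x] ground_potential_upper[OF \<alpha>, of x] by simp
  qed simp
  ultimately have "0 \<le> kappa1 \<alpha> * 2 powr \<alpha> + 2 powr (\<alpha> - 1) * (1 - 1\<^sup>2)"
    by (rule tendsto_lowerbound) simp
  then show ?thesis by (simp add: zero_le_mult_iff)
qed

section \<open>The hyperbolic chart of an interval\<close>

definition chart :: "real \<Rightarrow> real \<Rightarrow> real \<Rightarrow> real" where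
  "chart a b \<xi> = (a + b) / 2 + (b - a) / 2 * tanh \<xi>"

lemma one_minus_tanh_sq: "1 - (tanh \<xi>)\<^sup>2 = 1 / (cosh \<xi>)\<^sup>2" for \<xi> :: real
proof -
  have "1 - (tanh \<xi>)\<^sup>2 = ((cosh \<xi>)\<^sup>2 - (sinh \<xi>)\<^sup>2) / (cosh \<xi>)\<^sup>2"
    by (simp add: tanh_def power_divide diff_divide_distrib)
  then show ?thesis by (simp add: hyperbolic_pythagoras)
qed

lemma one_minus_tanh_sq_powr:
  "(1 - (tanh s)\<^sup>2) powr p = cosh s powr (- 2 * p)" for s p :: real
proof -
  have "1 - (tanh s)\<^sup>2 = cosh s powr (- 2)"
    using cosh_real_pos[of s] by (simp add: one_minus_tanh_sq powr_minus_divide)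
  then show ?thesis by (simp add: powr_powr)
qed

lemma chart_in: "a < b \<Longrightarrow> chart a b \<xi> \<in> {a<..<b}"
proof -
  assume ab: "a < b"
  have "0 < (b - a) / 2 * (1 - tanh \<xi>)" "0 < (b - a) / 2 * (tanh \<xi> + 1)"
    using ab tanh_real_lt_1[of \<xi>] tanh_real_gt_neg1[of \<xi>] by (auto intro!: mult_pos_pos)
  then show ?thesis unfolding chart_def by (auto simp: field_simps)
qed

lemma chart_has_derivative:
  "(chart a b has_real_derivative (b - a) / 2 * (1 - (tanh \<xi>)\<^sup>2)) (at \<xi>)"
  unfolding chart_def by (auto intro!: derivative_eq_intros)

lemma chart_mono: "a < b \<Longrightarrow> \<xi> \<le> \<eta> \<Longrightarrow> chart a b \<xi> \<le> chart a b \<eta>"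
  unfolding chart_def by (auto intro!: mult_left_mono)

text \<open>The substitution rule on the compact intervals \<open>[-n, n]\<close>, extended by monotone convergence to the
whole line. The function \<open>f\<close> is allowed to be infinite, because it will be an inner integral of the
energy.\<close>

lemma nn_integral_chart:
  fixes f :: "real \<Rightarrow> ennreal"
  assumes ab: "a < b" and [measurable]: "f \<in> borel_measurable borel"
  shows "(\<integral>\<^sup>+x. f x * indicator {a<..<b} x \<partial>lborel)
       = (\<integral>\<^sup>+\<xi>. f (chart a b \<xi>) * ennreal ((b - a) / 2 * (1 - (tanh \<xi>)\<^sup>2)) \<partial>lborel)"
proof -
  let ?g = "chart a b"
  let ?g' = "\<lambda>\<xi>. (b - a) / 2 * (1 - (tanh \<xi>)\<^sup>2)"
  let ?n = "\<lambda>n::nat. real (Suc n)"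
  have g'0: "0 \<le> ?g' \<xi>" for \<xi> using ab by (simp add: one_minus_tanh_sq)
  have cg: "continuous_on A ?g" for A
    unfolding chart_def by (intro continuous_intros) auto
  have [measurable]: "?g \<in> borel_measurable borel"
    by (rule borel_measurable_continuous_onI[OF cg])
  have [measurable]: "?g' \<in> borel_measurable borel"
    by (intro borel_measurable_continuous_onI continuous_intros) auto
  have eq: "(\<integral>\<^sup>+x. f x * indicator {?g (- ?n n)..?g (?n n)} x \<partial>lborel)
        = (\<integral>\<^sup>+\<xi>. f (?g \<xi>) * ?g' \<xi> * indicator {- ?n n..?n n} \<xi> \<partial>lborel)" for n
    by (rule nn_integral_substitution_aux; (rule chart_has_derivative g'0)?)
       (auto intro!: continuous_intros)
  have L1: "(\<lambda>n. \<integral>\<^sup>+\<xi>. f (?g \<xi>) * ?g' \<xi> * indicator {- ?n n..?n n} \<xi> \<partial>lborel)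
        \<longlonglongrightarrow> (\<integral>\<^sup>+\<xi>. f (?g \<xi>) * ?g' \<xi> \<partial>lborel)"
  proof (rule nn_integral_LIMSEQ)
    show "incseq (\<lambda>n \<xi>. f (?g \<xi>) * ?g' \<xi> * indicator {- ?n n..?n n} \<xi>)"
      by (auto simp: incseq_def le_fun_def intro!: mult_left_mono split: split_indicator)
    fix \<xi> :: real
    obtain n0 where n0: "\<bar>\<xi>\<bar> \<le> real n0" using real_arch_simple by blast
    have "f (?g \<xi>) * ?g' \<xi> * indicator {- ?n n..?n n} \<xi> = f (?g \<xi>) * ?g' \<xi>" if "n \<ge> n0" for n
      using n0 that by (auto split: split_indicator)
    then show "(\<lambda>n. f (?g \<xi>) * ?g' \<xi> * indicator {- ?n n..?n n} \<xi>) \<longlonglongrightarrow> f (?g \<xi>) * ?g' \<xi>"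
      by (intro tendsto_eventually eventually_sequentiallyI) auto
  qed measurable
  have L2: "(\<lambda>n. \<integral>\<^sup>+x. f x * indicator {?g (- ?n n)..?g (?n n)} x \<partial>lborel)
        \<longlonglongrightarrow> (\<integral>\<^sup>+x. f x * indicator {a<..<b} x \<partial>lborel)"
  proof (rule nn_integral_LIMSEQ)
    have *: "indicator {?g (- ?n m)..?g (?n m)} x \<le> (indicator {?g (- ?n n)..?g (?n n)} x::ennreal)"
      if "m \<le> n" for m n x
    proof -
      have "{?g (- ?n m)..?g (?n m)} \<subseteq> {?g (- ?n n)..?g (?n n)}"
        using chart_mono[OF ab, of "- ?n n" "- ?n m"] chart_mono[OF ab, of "?n m" "?n n"] that by auto
      then show ?thesis by (auto split: split_indicator)
    qed
    show "incseq (\<lambda>n x. f x * indicator {?g (- ?n n)..?g (?n n)} x)"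
      unfolding incseq_def le_fun_def by (intro allI impI mult_left_mono *) auto
    fix x :: real
    show "(\<lambda>n. f x * indicator {?g (- ?n n)..?g (?n n)} x) \<longlonglongrightarrow> f x * indicator {a<..<b} x"
    proof (cases "x \<in> {a<..<b}")
      case False
      have "x \<notin> {?g (- ?n n)..?g (?n n)}" for n
        using False chart_in[OF ab, of "- ?n n"] chart_in[OF ab, of "?n n"] by auto
      then show ?thesis using False by simp
    next
      case True
      have tt: "filterlim ?n at_top sequentially"
        by (rule filterlim_compose[OF filterlim_real_sequentially filterlim_Suc])
      have "(\<lambda>n. ?g (?n n)) \<longlonglongrightarrow> (a + b) / 2 + (b - a) / 2 * 1"
        unfolding chart_def by (intro tendsto_intros filterlim_compose[OF tanh_real_at_top tt])
      then have 1: "\<forall>\<^sub>F n in sequentially. x < ?g (?n n)"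
        by (rule order_tendstoD) (use True in \<open>auto simp: field_simps\<close>)
      have "(\<lambda>n. ?g (- ?n n)) \<longlonglongrightarrow> (a + b) / 2 + (b - a) / 2 * (- 1)"
        unfolding chart_def
        by (intro tendsto_intros filterlim_compose[OF tanh_real_at_bot]
             filterlim_compose[OF filterlim_uminus_at_bot_at_top tt])
      then have 2: "\<forall>\<^sub>F n in sequentially. ?g (- ?n n) < x"
        by (rule order_tendstoD) (use True in \<open>auto simp: field_simps\<close>)
      show ?thesis
      proof (rule tendsto_eventually)
        show "\<forall>\<^sub>F n in sequentially.
            f x * indicator {?g (- ?n n)..?g (?n n)} x = f x * indicator {a<..<b} x"
          using eventually_conj[OF 1 2] by (rule eventually_mono) (use True in auto)
      qed
    qed
  qed measurable
  show ?thesis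
    using LIMSEQ_unique[OF L2 L1[folded eq]] .
qed

lemma borel_measurable_chart [measurable]: "chart a b \<in> borel_measurable borel"
  unfolding chart_def by (intro borel_measurable_continuous_onI continuous_intros) auto

lemma borel_measurable_cosh_tanh [measurable]:
  "cosh \<in> borel_measurable (borel :: real measure)"
  "tanh \<in> borel_measurable (borel :: real measure)"
  by (intro borel_measurable_continuous_onI continuous_intros; simp)+

section \<open>The weight and the kernel on the line\<close>

definition cosh_weight :: "real \<Rightarrow> real \<Rightarrow> real" where
  "cosh_weight \<alpha> \<xi> = cosh \<xi> powr (\<alpha> - 1)"

definition sinh_kernel :: "real \<Rightarrow> real \<Rightarrow> real" where
  "sinh_kernel \<alpha> s = \<bar>sinh s\<bar> powr (- 1 - \<alpha>)"

definition second_difference :: "real \<Rightarrow> real \<Rightarrow> real \<Rightarrow> real" where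
  "second_difference \<alpha> \<xi> s =
     (cosh_weight \<alpha> (\<xi> + s) + cosh_weight \<alpha> (\<xi> - s)) / cosh_weight \<alpha> \<xi> - 2"

lemma cosh_weight_pos: "0 < cosh_weight \<alpha> \<xi>"
  using cosh_real_pos[of \<xi>] by (simp add: cosh_weight_def)

lemma borel_measurable_cosh_weight [measurable]: "cosh_weight \<alpha> \<in> borel_measurable borel"
proof -
  have "cosh \<in> borel_measurable (borel :: real measure)"
    by (intro borel_measurable_continuous_onI continuous_intros)
  then show ?thesis unfolding cosh_weight_def by measurable
qed

lemma borel_measurable_sinh_kernel [measurable]: "sinh_kernel \<alpha> \<in> borel_measurable borel"
proof -
  have "sinh \<in> borel_measurable (borel :: real measure)"
    by (intro borel_measurable_continuous_onI continuous_intros)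
  then show ?thesis unfolding sinh_kernel_def by measurable
qed

lemma borel_measurable_second_difference [measurable (raw)]:
  assumes [measurable]: "f \<in> borel_measurable M" "g \<in> borel_measurable M"
  shows "(\<lambda>x. second_difference \<alpha> (f x) (g x)) \<in> borel_measurable M"
  unfolding second_difference_def by measurable

lemma sinh_kernel_nonneg: "0 \<le> sinh_kernel \<alpha> s"
  by (simp add: sinh_kernel_def)

lemma abs_sinh_eq: "\<bar>sinh s\<bar> = \<bar>tanh s\<bar> * cosh s" for s :: real
  by (simp add: tanh_def)

text \<open>Used to dominate \<open>s\<^sup>2 * sinh_kernel \<alpha> s\<close> by a power of \<open>sinh s\<close>, whose integral is again of Beta type.\<close>

lemma sq_le_sinh_sq: "s\<^sup>2 \<le> (sinh s)\<^sup>2" for s :: real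
proof -
  have "u \<le> sinh u" if "0 \<le> u" for u :: real
  proof -
    have "sinh 0 - 0 \<le> sinh u - u"
    proof (rule DERIV_nonneg_imp_nondecreasing[OF that])
      fix w :: real
      have "((\<lambda>u. sinh u - u) has_real_derivative cosh w - 1) (at w)"
        by (auto intro!: derivative_eq_intros)
      then show "\<exists>d. ((\<lambda>u. sinh u - u) has_real_derivative d) (at w) \<and> 0 \<le> d"
        using cosh_real_ge_1[of w] by (intro exI[of _ "cosh w - 1"]) auto
    qed
    then show ?thesis by simp
  qed
  from this[of s] this[of "- s"] show ?thesis
    by (subst abs_le_square_iff[symmetric]) (simp add: abs_if)
qed

lemma cosh_weight_shift:
  "cosh_weight \<alpha> (\<xi> + s) / cosh_weight \<alpha> \<xi>
     = cosh s powr (\<alpha> - 1) * (1 + tanh \<xi> * tanh s) powr (\<alpha> - 1)"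
proof -
  have "cosh (\<xi> + s) = cosh \<xi> * (cosh s * (1 + tanh \<xi> * tanh s))"
    by (simp add: cosh_add tanh_def field_simps)
  then show ?thesis by (simp add: cosh_weight_def powr_mult)
qed

text \<open>Everything is expressed in \<open>tanh \<xi>\<close> and \<open>tanh s\<close>, up to the power of \<open>cosh s\<close> that, together with the one
from the kernel, becomes the Jacobian of \<open>t = tanh s\<close>.\<close>

lemma second_difference_eq:
  "second_difference \<alpha> \<xi> s = cosh s powr (\<alpha> - 1) *
     ((1 + tanh \<xi> * tanh s) powr (\<alpha> - 1) + (1 - tanh \<xi> * tanh s) powr (\<alpha> - 1)
      - 2 * (1 - (tanh s)\<^sup>2) powr ((\<alpha> - 1) / 2))"
proof -
  have "cosh s powr (\<alpha> - 1) * (1 - (tanh s)\<^sup>2) powr ((\<alpha> - 1) / 2) = 1"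
    unfolding one_minus_tanh_sq_powr by (simp add: diff_divide_distrib flip: powr_add)
  then show ?thesis
    using cosh_weight_shift[of \<alpha> \<xi> s] cosh_weight_shift[of \<alpha> \<xi> "- s"]
    by (simp add: second_difference_def add_divide_distrib algebra_simps)
qed

lemma second_difference_nonneg:
  assumes "1 < \<alpha>"
  shows "0 \<le> second_difference \<alpha> \<xi> s"
  unfolding second_difference_eq
  using geometric_mean_bound[of "\<alpha> - 1" "tanh \<xi>" "tanh s"] assms tanh_real_bounds[of \<xi>] tanh_real_bounds[of s]
  by (intro mult_nonneg_nonneg) auto

text \<open>The substitution \<open>t = tanh s\<close>, which is the chart of \<open>(-1, 1)\<close>, followed by a reflection.\<close>

lemma nn_integral_tanh:
  fixes f :: "real \<Rightarrow> ennreal"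
  assumes [measurable]: "f \<in> borel_measurable borel" and even: "\<And>t. f (- t) = f t"
  shows "(\<integral>\<^sup>+s. f (tanh s) * ennreal (1 - (tanh s)\<^sup>2) \<partial>lborel)
       = 2 * (\<integral>\<^sup>+t. f t * indicator {0..1} t \<partial>lborel)"
proof -
  have "(\<integral>\<^sup>+s. f (tanh s) * ennreal (1 - (tanh s)\<^sup>2) \<partial>lborel)
      = (\<integral>\<^sup>+t. f t * indicator {-1<..<1} t \<partial>lborel)"
    by (subst nn_integral_chart) (simp_all add: chart_def)
  also have "\<dots> = (\<integral>\<^sup>+t. f t * indicator {0..1} t + f t * indicator {-1..0} t \<partial>lborel)"
  proof (rule nn_integral_cong_AE)
    show "AE t in lborel. f t * indicator {-1<..<1} t = f t * indicator {0..1} t + f t * indicator {-1..0} t"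
      using AE_lborel_singleton[of "0::real"] AE_lborel_singleton[of "1::real"] AE_lborel_singleton[of "-1::real"]
      by eventually_elim (auto split: split_indicator)
  qed
  also have "\<dots> = (\<integral>\<^sup>+t. f t * indicator {0..1} t \<partial>lborel) + (\<integral>\<^sup>+t. f t * indicator {-1..0} t \<partial>lborel)"
    by (rule nn_integral_add) auto
  also have "(\<integral>\<^sup>+t. f t * indicator {-1..0} t \<partial>lborel) = (\<integral>\<^sup>+t. f t * indicator {0..1} t \<partial>lborel)"
    by (subst nn_integral_real_affine[where c = "-1" and t = 0])
       (auto simp: even intro!: nn_integral_cong split: split_indicator)
  finally show ?thesis by (simp add: mult_2)
qed

text \<open>With \<open>t = tanh s\<close> the powers of \<open>cosh s\<close> in the second difference and in the kernel combine to
\<open>(cosh s) powr (- 2)\<close>, the Jacobian, so that exactly the integral of \<open>has_integral_potential\<close> remains.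
This is what distinguishes the exponent \<open>\<alpha> - 1\<close> in the weight.\<close>

lemma nn_integral_second_difference:
  assumes \<alpha>: "1 < \<alpha>" "\<alpha> < 2"
  shows "(\<integral>\<^sup>+s. ennreal (second_difference \<alpha> \<xi> s * sinh_kernel \<alpha> s) \<partial>lborel)
    = ennreal (2 * ground_potential \<alpha> (tanh \<xi>))"
    (is "_ = ennreal (2 * ?I)")
proof -
  define x where "x = tanh \<xi>"
  have x: "\<bar>x\<bar> < 1" using tanh_real_bounds[of \<xi>] by (auto simp: x_def)
  define \<phi> where "\<phi> t = ((1 + x * t) powr (\<alpha> - 1) + (1 - x * t) powr (\<alpha> - 1)
      - 2 * (1 - t\<^sup>2) powr ((\<alpha> - 1) / 2)) * \<bar>t\<bar> powr (- 1 - \<alpha>)" for t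
  have [measurable]: "\<phi> \<in> borel_measurable borel" unfolding \<phi>_def by measurable
  have "second_difference \<alpha> \<xi> s * sinh_kernel \<alpha> s = \<phi> (tanh s) * (1 - (tanh s)\<^sup>2)" for s
  proof -
    have *: "cosh s powr (\<alpha> - 1) * cosh s powr (- 1 - \<alpha>) = 1 - (tanh s)\<^sup>2"
      using one_minus_tanh_sq_powr[of s 1] one_minus_tanh_sq[of s]
      by (simp flip: powr_add)
    show ?thesis
      unfolding second_difference_eq sinh_kernel_def \<phi>_def abs_sinh_eq x_def powr_mult *[symmetric]
      by (simp only: ac_simps)
  qed
  then have "(\<integral>\<^sup>+s. ennreal (second_difference \<alpha> \<xi> s * sinh_kernel \<alpha> s) \<partial>lborel)
      = (\<integral>\<^sup>+s. ennreal (\<phi> (tanh s)) * ennreal (1 - (tanh s)\<^sup>2) \<partial>lborel)"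
    by (simp add: one_minus_tanh_sq flip: ennreal_mult'')
  also have "\<dots> = 2 * (\<integral>\<^sup>+t. ennreal (\<phi> t) * indicator {0..1} t \<partial>lborel)"
    by (rule nn_integral_tanh) (auto simp: \<phi>_def add.commute)
  also have "(\<integral>\<^sup>+t. ennreal (\<phi> t) * indicator {0..1} t \<partial>lborel) = ennreal ?I"
  proof (rule nn_integral_has_integral_lebesgue')
    show "0 \<le> \<phi> t" if "t \<in> {0..1}" for t
      using geometric_mean_bound[of "\<alpha> - 1" x t] that \<alpha> x by (auto simp: \<phi>_def)
    show "(\<phi> has_integral ?I) {0..1}"
      using has_integral_potential[OF \<alpha> x] unfolding \<phi>_def x_def
      by (rule has_integral_cong[THEN iffD1, rotated]) simp
  qed
  also have "2 * ennreal ?I = ennreal (2 * ?I)"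
    by (subst ennreal_mult') simp_all
  finally show ?thesis .
qed

text \<open>Only finiteness matters: this integral controls the energy of slowly varying functions on the line.\<close>

lemma nn_integral_sq_sinh_kernel:
  assumes \<alpha>: "1 < \<alpha>" "\<alpha> < 2"
  shows "(\<integral>\<^sup>+s. ennreal (s\<^sup>2 * sinh_kernel \<alpha> s) \<partial>lborel) \<le> ennreal (Beta (1 - \<alpha> / 2) ((\<alpha> - 1) / 2))"
proof -
  define \<phi> where "\<phi> t = \<bar>t\<bar> powr (1 - \<alpha>) * (1 - t\<^sup>2) powr ((\<alpha> - 1) / 2 - 1)" for t :: real
  have [measurable]: "\<phi> \<in> borel_measurable borel" unfolding \<phi>_def by measurable
  have "s\<^sup>2 * sinh_kernel \<alpha> s \<le> \<phi> (tanh s) * (1 - (tanh s)\<^sup>2)" for s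
  proof -
    have "s\<^sup>2 * sinh_kernel \<alpha> s \<le> \<bar>sinh s\<bar> powr 2 * sinh_kernel \<alpha> s"
      using sq_le_sinh_sq by (intro mult_right_mono sinh_kernel_nonneg) simp
    also have "\<dots> = \<bar>sinh s\<bar> powr (1 - \<alpha>)"
      unfolding sinh_kernel_def by (simp add: powr_add[symmetric] del: powr_numeral)
    also have "\<dots> = \<bar>tanh s\<bar> powr (1 - \<alpha>) * cosh s powr (1 - \<alpha>)"
      by (simp add: abs_sinh_eq powr_mult)
    also have "cosh s powr (1 - \<alpha>) = (1 - (tanh s)\<^sup>2) powr ((\<alpha> - 1) / 2 - 1) * (1 - (tanh s)\<^sup>2) powr 1"
      unfolding powr_add[symmetric] one_minus_tanh_sq_powr by (simp add: diff_divide_distrib)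
    also have "(1 - (tanh s)\<^sup>2) powr 1 = 1 - (tanh s)\<^sup>2" by (simp add: one_minus_tanh_sq)
    finally show ?thesis by (simp add: \<phi>_def)
  qed
  then have "(\<integral>\<^sup>+s. ennreal (s\<^sup>2 * sinh_kernel \<alpha> s) \<partial>lborel)
      \<le> (\<integral>\<^sup>+s. ennreal (\<phi> (tanh s)) * ennreal (1 - (tanh s)\<^sup>2) \<partial>lborel)"
    by (intro nn_integral_mono) (simp add: one_minus_tanh_sq ennreal_leI flip: ennreal_mult'')
  also have "\<dots> = 2 * (\<integral>\<^sup>+t. ennreal (\<phi> t) * indicator {0..1} t \<partial>lborel)"
    by (rule nn_integral_tanh) (auto simp: \<phi>_def)
  also have "(\<integral>\<^sup>+t. ennreal (\<phi> t) * indicator {0..1} t \<partial>lborel)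
      = ennreal (Beta (1 - \<alpha> / 2) ((\<alpha> - 1) / 2) / 2)"
  proof (rule nn_integral_has_integral_lebesgue')
    show "0 \<le> \<phi> t" for t by (simp add: \<phi>_def)
    have "((\<lambda>t. t powr (2 * (1 - \<alpha> / 2) - 1) * (1 - t\<^sup>2) powr ((\<alpha> - 1) / 2 - 1))
        has_integral Beta (1 - \<alpha> / 2) ((\<alpha> - 1) / 2) / 2) {0..1}"
      by (rule has_integral_Beta_squared) (use \<alpha> in auto)
    then show "(\<phi> has_integral Beta (1 - \<alpha> / 2) ((\<alpha> - 1) / 2) / 2) {0..1}"
      unfolding \<phi>_def by (rule has_integral_cong[THEN iffD1, rotated]) simp
  qed
  also have "2 * ennreal (Beta (1 - \<alpha> / 2) ((\<alpha> - 1) / 2) / 2) = ennreal (Beta (1 - \<alpha> / 2) ((\<alpha> - 1) / 2))"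
    by (simp flip: ennreal_numeral ennreal_mult')
  finally show ?thesis .
qed

section \<open>The ground state identity\<close>

lemma nn_integral_shift:
  fixes f :: "real \<Rightarrow> ennreal"
  assumes "f \<in> borel_measurable borel"
  shows "(\<integral>\<^sup>+\<xi>. f (\<xi> + s) \<partial>lborel) = (\<integral>\<^sup>+\<xi>. f \<xi> \<partial>lborel)"
  using nn_integral_real_affine[OF assms, of 1 s] by (simp add: add.commute)

lemma nn_integral_times_const:
  fixes f :: "'a \<Rightarrow> real"
  assumes "f \<in> borel_measurable M" "0 \<le> c"
  shows "(\<integral>\<^sup>+x. ennreal (f x * c) \<partial>M) = ennreal c * (\<integral>\<^sup>+x. ennreal (f x) \<partial>M)"
  using assms by (subst nn_integral_cmult[symmetric]) (auto simp: ennreal_mult' mult.commute)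

text \<open>For \<open>A, B > 0\<close> one has
\<open>(x / A - y / B)\<^sup>2 * A * B = (x - y)\<^sup>2 + x\<^sup>2 * (B / A - 1) + y\<^sup>2 * (A / B - 1)\<close>, and translating by \<open>s\<close> turns the
last term into \<open>(v \<xi>)\<^sup>2 * (H (\<xi> - s) / H \<xi> - 1)\<close>. Since \<open>B / A - 1\<close> may be negative, twice the integral of
\<open>v\<^sup>2\<close> is added to both sides, so that only integrals of nonnegative functions occur; finiteness of that
integral allows it to be cancelled at the end.\<close>

lemma ground_state_identity_shift:
  fixes v :: "real \<Rightarrow> real"
  assumes \<alpha>: "1 < \<alpha>" and [measurable]: "v \<in> borel_measurable borel"
    and fin: "(\<integral>\<^sup>+\<xi>. ennreal ((v \<xi>)\<^sup>2) \<partial>lborel) < \<infinity>"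
  defines "H \<equiv> cosh_weight \<alpha>"
  shows "(\<integral>\<^sup>+\<xi>. ennreal ((v \<xi> / H \<xi> - v (\<xi> + s) / H (\<xi> + s))\<^sup>2 * (H \<xi> * H (\<xi> + s))) \<partial>lborel)
    = (\<integral>\<^sup>+\<xi>. ennreal ((v \<xi> - v (\<xi> + s))\<^sup>2) \<partial>lborel)
    + (\<integral>\<^sup>+\<xi>. ennreal ((v \<xi>)\<^sup>2 * second_difference \<alpha> \<xi> s) \<partial>lborel)"
    (is "?L = ?P + ?G")
proof -
  have [measurable]: "H \<in> borel_measurable borel" unfolding H_def by measurable
  have H: "0 < H \<xi>" for \<xi> by (simp add: H_def cosh_weight_pos)
  have H': "H \<xi> \<noteq> 0" "0 \<le> H \<xi>" for \<xi> using H[of \<xi>] by auto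
  let ?N = "\<integral>\<^sup>+\<xi>. ennreal ((v \<xi>)\<^sup>2) \<partial>lborel"
  let ?X = "\<integral>\<^sup>+\<xi>. ennreal ((v \<xi>)\<^sup>2 * (H (\<xi> + s) / H \<xi>)) \<partial>lborel"
  let ?Y = "\<integral>\<^sup>+\<xi>. ennreal ((v \<xi>)\<^sup>2 * (H (\<xi> - s) / H \<xi>)) \<partial>lborel"
  have N: "(\<integral>\<^sup>+\<xi>. ennreal ((v (\<xi> + s))\<^sup>2) \<partial>lborel) = ?N"
    by (rule nn_integral_shift[of "\<lambda>\<xi>. ennreal ((v \<xi>)\<^sup>2)"]) measurable
  have Y: "(\<integral>\<^sup>+\<xi>. ennreal ((v (\<xi> + s))\<^sup>2 * (H \<xi> / H (\<xi> + s))) \<partial>lborel) = ?Y"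
    using nn_integral_shift[of "\<lambda>\<xi>. ennreal ((v \<xi>)\<^sup>2 * (H (\<xi> - s) / H \<xi>))" s] by simp
  have alg: "(x / A - y / B)\<^sup>2 * (A * B) + (x\<^sup>2 + y\<^sup>2) = (x - y)\<^sup>2 + (x\<^sup>2 * (B / A) + y\<^sup>2 * (A / B))"
    if "A \<noteq> 0" "B \<noteq> 0" for x y A B :: real
    using that by (simp add: field_simps power2_eq_square)
  \<comment> \<open>One copy of \<open>?N\<close> compensates each of the two subtracted ones.\<close>
  have "?L + (?N + ?N) = (\<integral>\<^sup>+\<xi>. ennreal ((v \<xi> / H \<xi> - v (\<xi> + s) / H (\<xi> + s))\<^sup>2 * (H \<xi> * H (\<xi> + s))
      + ((v \<xi>)\<^sup>2 + (v (\<xi> + s))\<^sup>2)) \<partial>lborel)"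
    by (simp add: nn_integral_add ennreal_plus H' N del: ennreal_plus[symmetric])
  also have "\<dots> = (\<integral>\<^sup>+\<xi>. ennreal ((v \<xi> - v (\<xi> + s))\<^sup>2
      + ((v \<xi>)\<^sup>2 * (H (\<xi> + s) / H \<xi>) + (v (\<xi> + s))\<^sup>2 * (H \<xi> / H (\<xi> + s)))) \<partial>lborel)"
    by (intro nn_integral_cong arg_cong[where f = ennreal] alg H')
  also have "\<dots> = ?P + (?X + ?Y)"
    using H' Y by (simp add: nn_integral_add ennreal_plus del: times_divide_eq_right)
  finally have 1: "?L + (?N + ?N) = ?P + (?X + ?Y)" .
  have "?G + (?N + ?N) = (\<integral>\<^sup>+\<xi>. ennreal ((v \<xi>)\<^sup>2 * second_difference \<alpha> \<xi> s)
      + (ennreal ((v \<xi>)\<^sup>2) + ennreal ((v \<xi>)\<^sup>2)) \<partial>lborel)"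
    by (simp add: nn_integral_add)
  also have "\<dots> = (\<integral>\<^sup>+\<xi>. ennreal ((v \<xi>)\<^sup>2 * (H (\<xi> + s) / H \<xi>) + (v \<xi>)\<^sup>2 * (H (\<xi> - s) / H \<xi>)) \<partial>lborel)"
  proof (rule nn_integral_cong)
    fix \<xi> :: real
    have e: "(v \<xi>)\<^sup>2 * (H (\<xi> + s) / H \<xi>) + (v \<xi>)\<^sup>2 * (H (\<xi> - s) / H \<xi>)
        = (v \<xi>)\<^sup>2 * second_difference \<alpha> \<xi> s + ((v \<xi>)\<^sup>2 + (v \<xi>)\<^sup>2)"
      by (simp add: second_difference_def H_def add_divide_distrib algebra_simps)
    show "ennreal ((v \<xi>)\<^sup>2 * second_difference \<alpha> \<xi> s) + (ennreal ((v \<xi>)\<^sup>2) + ennreal ((v \<xi>)\<^sup>2))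
        = ennreal ((v \<xi>)\<^sup>2 * (H (\<xi> + s) / H \<xi>) + (v \<xi>)\<^sup>2 * (H (\<xi> - s) / H \<xi>))"
      by (simp only: e ennreal_plus zero_le_power2 mult_nonneg_nonneg add_nonneg_nonneg
          second_difference_nonneg[OF \<alpha>])
  qed
  also have "\<dots> = ?X + ?Y"
    using H' by (simp add: nn_integral_add ennreal_plus del: times_divide_eq_right)
  finally have 2: "?G + (?N + ?N) = ?X + ?Y" .
  have "?L + (?N + ?N) = (?P + ?G) + (?N + ?N)"
    unfolding 1 2[symmetric] by (simp only: add.assoc)
  then have "(?N + ?N) + ?L = (?N + ?N) + (?P + ?G)"
    by (simp only: add.commute[of "?N + ?N"])
  then show ?thesis using fin by (simp only: ennreal_add_left_cancel) auto
qed

text \<open>Both exchanges of integrals are Tonelli's theorem: in the first place to hold \<open>s = \<eta> - \<xi>\<close> fixed, and then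
to integrate over \<open>s\<close> first in the potential term.\<close>

lemma ground_state_identity:
  fixes v :: "real \<Rightarrow> real"
  assumes \<alpha>: "1 < \<alpha>" and [measurable]: "v \<in> borel_measurable borel"
    and fin: "(\<integral>\<^sup>+\<xi>. ennreal ((v \<xi>)\<^sup>2) \<partial>lborel) < \<infinity>"
  defines "H \<equiv> cosh_weight \<alpha>"
  shows "(\<integral>\<^sup>+\<xi>. (\<integral>\<^sup>+\<eta>. ennreal ((v \<xi> / H \<xi> - v \<eta> / H \<eta>)\<^sup>2 * (H \<xi> * H \<eta>) * sinh_kernel \<alpha> (\<eta> - \<xi>)) \<partial>lborel) \<partial>lborel)
    = (\<integral>\<^sup>+s. ennreal (sinh_kernel \<alpha> s) * (\<integral>\<^sup>+\<xi>. ennreal ((v \<xi> - v (\<xi> + s))\<^sup>2) \<partial>lborel) \<partial>lborel)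
    + (\<integral>\<^sup>+\<xi>. ennreal ((v \<xi>)\<^sup>2) * (\<integral>\<^sup>+s. ennreal (second_difference \<alpha> \<xi> s * sinh_kernel \<alpha> s) \<partial>lborel) \<partial>lborel)"
proof -
  have [measurable]: "H \<in> borel_measurable borel" unfolding H_def by measurable
  have H: "0 \<le> H \<xi>" for \<xi> by (simp add: H_def cosh_weight_pos less_imp_le)
  let ?D = "\<lambda>\<xi> s. (v \<xi> / H \<xi> - v (\<xi> + s) / H (\<xi> + s))\<^sup>2 * (H \<xi> * H (\<xi> + s))"
  have "(\<integral>\<^sup>+\<eta>. ennreal ((v \<xi> / H \<xi> - v \<eta> / H \<eta>)\<^sup>2 * (H \<xi> * H \<eta>) * sinh_kernel \<alpha> (\<eta> - \<xi>)) \<partial>lborel)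
      = (\<integral>\<^sup>+s. ennreal (?D \<xi> s * sinh_kernel \<alpha> s) \<partial>lborel)" for \<xi>
    by (subst nn_integral_real_affine[where c = 1 and t = \<xi>]) simp_all
  then have "(\<integral>\<^sup>+\<xi>. (\<integral>\<^sup>+\<eta>. ennreal ((v \<xi> / H \<xi> - v \<eta> / H \<eta>)\<^sup>2 * (H \<xi> * H \<eta>) * sinh_kernel \<alpha> (\<eta> - \<xi>)) \<partial>lborel) \<partial>lborel)
      = (\<integral>\<^sup>+\<xi>. (\<integral>\<^sup>+s. ennreal (?D \<xi> s * sinh_kernel \<alpha> s) \<partial>lborel) \<partial>lborel)"
    by simp
  also have "\<dots> = (\<integral>\<^sup>+s. (\<integral>\<^sup>+\<xi>. ennreal (?D \<xi> s * sinh_kernel \<alpha> s) \<partial>lborel) \<partial>lborel)"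
    by (rule lborel_pair.Fubini'[symmetric]) measurable
  also have "\<dots> = (\<integral>\<^sup>+s. ennreal (sinh_kernel \<alpha> s) * (\<integral>\<^sup>+\<xi>. ennreal (?D \<xi> s) \<partial>lborel) \<partial>lborel)"
    by (simp add: nn_integral_times_const sinh_kernel_nonneg)
  also have "\<dots> = (\<integral>\<^sup>+s. ennreal (sinh_kernel \<alpha> s) * (\<integral>\<^sup>+\<xi>. ennreal ((v \<xi> - v (\<xi> + s))\<^sup>2) \<partial>lborel)
      + (\<integral>\<^sup>+\<xi>. ennreal ((v \<xi>)\<^sup>2 * second_difference \<alpha> \<xi> s * sinh_kernel \<alpha> s) \<partial>lborel) \<partial>lborel)"
  proof (rule nn_integral_cong)
    fix s :: real
    have "(\<integral>\<^sup>+\<xi>. ennreal ((v \<xi>)\<^sup>2 * second_difference \<alpha> \<xi> s * sinh_kernel \<alpha> s) \<partial>lborel)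
        = ennreal (sinh_kernel \<alpha> s) * (\<integral>\<^sup>+\<xi>. ennreal ((v \<xi>)\<^sup>2 * second_difference \<alpha> \<xi> s) \<partial>lborel)"
      by (simp add: nn_integral_times_const sinh_kernel_nonneg)
    then show "ennreal (sinh_kernel \<alpha> s) * (\<integral>\<^sup>+\<xi>. ennreal (?D \<xi> s) \<partial>lborel)
        = ennreal (sinh_kernel \<alpha> s) * (\<integral>\<^sup>+\<xi>. ennreal ((v \<xi> - v (\<xi> + s))\<^sup>2) \<partial>lborel)
        + (\<integral>\<^sup>+\<xi>. ennreal ((v \<xi>)\<^sup>2 * second_difference \<alpha> \<xi> s * sinh_kernel \<alpha> s) \<partial>lborel)"
      using ground_state_identity_shift[OF \<alpha> assms(2) fin, of s]
      by (simp add: H_def distrib_left)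
  qed
  also have "\<dots> = (\<integral>\<^sup>+s. ennreal (sinh_kernel \<alpha> s) * (\<integral>\<^sup>+\<xi>. ennreal ((v \<xi> - v (\<xi> + s))\<^sup>2) \<partial>lborel) \<partial>lborel)
      + (\<integral>\<^sup>+s. (\<integral>\<^sup>+\<xi>. ennreal ((v \<xi>)\<^sup>2 * second_difference \<alpha> \<xi> s * sinh_kernel \<alpha> s) \<partial>lborel) \<partial>lborel)"
    by (rule nn_integral_add) measurable
  also have "(\<integral>\<^sup>+s. (\<integral>\<^sup>+\<xi>. ennreal ((v \<xi>)\<^sup>2 * second_difference \<alpha> \<xi> s * sinh_kernel \<alpha> s) \<partial>lborel) \<partial>lborel)
      = (\<integral>\<^sup>+\<xi>. (\<integral>\<^sup>+s. ennreal ((v \<xi>)\<^sup>2 * second_difference \<alpha> \<xi> s * sinh_kernel \<alpha> s) \<partial>lborel) \<partial>lborel)"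
    by (rule lborel_pair.Fubini') measurable
  also have "\<dots> = (\<integral>\<^sup>+\<xi>. ennreal ((v \<xi>)\<^sup>2) * (\<integral>\<^sup>+s. ennreal (second_difference \<alpha> \<xi> s * sinh_kernel \<alpha> s) \<partial>lborel) \<partial>lborel)"
    by (subst nn_integral_cmult[symmetric]) (auto simp: mult.assoc ennreal_mult')
  finally show ?thesis .
qed

section \<open>Energy and weighted integrals in the chart\<close>

text \<open>The quotient of \<open>u\<close> by the ground state, in the coordinate of the chart. It determines \<open>u\<close> on
\<open>(a, b)\<close>.\<close>

definition log_profile :: "real \<Rightarrow> real \<Rightarrow> real \<Rightarrow> (real \<Rightarrow> real) \<Rightarrow> real \<Rightarrow> real" where
  "log_profile \<alpha> a b u \<xi> = u (chart a b \<xi>) * cosh_weight \<alpha> \<xi>"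

text \<open>The function \<open>u\<close> is arbitrary outside \<open>(a, b)\<close>, so it is first cut off by the indicator of the interval.\<close>

lemma borel_measurable_log_profile:
  assumes ab: "a < b" and u: "continuous_on {a<..<b} u"
  shows "log_profile \<alpha> a b u \<in> borel_measurable borel"
proof -
  have "(\<lambda>x. indicator {a<..<b} x *\<^sub>R u x) \<in> borel_measurable borel"
    by (rule borel_measurable_continuous_on_indicator[OF _ u]) simp
  then have [measurable]: "(\<lambda>x. indicator {a<..<b} x * u x) \<in> borel_measurable borel" by simp
  have "log_profile \<alpha> a b u = (\<lambda>\<xi>. (\<lambda>x. indicator {a<..<b} x * u x) (chart a b \<xi>) * cosh_weight \<alpha> \<xi>)"
    using chart_in[OF ab] by (auto simp: log_profile_def fun_eq_iff)
  also have "\<dots> \<in> borel_measurable borel" by measurable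
  finally show ?thesis .
qed

text \<open>In the chart, \<open>x - y = r * sinh (\<xi> - \<eta>) / (cosh \<xi> * cosh \<eta>)\<close>; the Jacobians take away two of the
\<open>1 + \<alpha>\<close> powers of each \<open>cosh\<close>. At \<open>\<xi> = \<eta>\<close> both sides vanish, since both the division by zero and the
power of zero are zero.\<close>

lemma kernel_in_chart:
  assumes ab: "a < b"
  shows "1 / \<bar>chart a b \<xi> - chart a b \<eta>\<bar> powr (1 + \<alpha>)
      * ((b - a) / 2 * (1 - (tanh \<eta>)\<^sup>2)) * ((b - a) / 2 * (1 - (tanh \<xi>)\<^sup>2))
    = ((b - a) / 2) powr (1 - \<alpha>) * (cosh_weight \<alpha> \<xi> * cosh_weight \<alpha> \<eta> * sinh_kernel \<alpha> (\<eta> - \<xi>))"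
proof -
  define r where "r = (b - a) / 2"
  have r: "0 < r" using ab by (simp add: r_def)
  have "tanh \<xi> - tanh \<eta> = sinh (\<xi> - \<eta>) / (cosh \<xi> * cosh \<eta>)"
    unfolding tanh_def sinh_diff by (simp add: diff_divide_distrib)
  moreover have "chart a b \<xi> - chart a b \<eta> = r * (tanh \<xi> - tanh \<eta>)"
    by (simp add: chart_def r_def right_diff_distrib)
  ultimately have "chart a b \<xi> - chart a b \<eta> = r * (sinh (\<xi> - \<eta>) / (cosh \<xi> * cosh \<eta>))"
    by (simp only:)
  moreover have "\<bar>sinh (\<xi> - \<eta>)\<bar> = \<bar>sinh (\<eta> - \<xi>)\<bar>"
    using sinh_minus[of "\<eta> - \<xi>"] by simp
  ultimately have d: "\<bar>chart a b \<xi> - chart a b \<eta>\<bar> = r * (\<bar>sinh (\<eta> - \<xi>)\<bar> / (cosh \<xi> * cosh \<eta>))"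
    using r by (simp add: abs_mult)
  have p: "r powr (1 - \<alpha>) = r\<^sup>2 / r powr (1 + \<alpha>)"
    "cosh \<zeta> powr (\<alpha> - 1) = cosh \<zeta> powr (1 + \<alpha>) / (cosh \<zeta>)\<^sup>2" for \<zeta> :: real
    using powr_diff[of r 2 "1 + \<alpha>"] powr_diff[of "cosh \<zeta>" "1 + \<alpha>" 2] r cosh_real_pos[of \<zeta>] by auto
  have "- 1 - \<alpha> = - (1 + \<alpha>)" by simp
  then have k: "sinh_kernel \<alpha> (\<eta> - \<xi>) = 1 / \<bar>sinh (\<eta> - \<xi>)\<bar> powr (1 + \<alpha>)"
    unfolding sinh_kernel_def by (simp only: powr_minus_divide)
  show ?thesis
    unfolding r_def[symmetric] d k cosh_weight_def p one_minus_tanh_sq powr_mult powr_divide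
    using r by (simp add: power2_eq_square mult_ac)
qed

lemma energy_eq_log_profile:
  fixes \<alpha> a b :: real
  assumes ab: "a < b" and u: "continuous_on {a<..<b} u"
  defines "H \<equiv> cosh_weight \<alpha>" and "v \<equiv> log_profile \<alpha> a b u"
  shows "energy \<alpha> a b u = ennreal (1 / 2) * (ennreal (((b - a) / 2) powr (1 - \<alpha>)) *
    (\<integral>\<^sup>+\<xi>. (\<integral>\<^sup>+\<eta>. ennreal ((v \<xi> / H \<xi> - v \<eta> / H \<eta>)\<^sup>2 * (H \<xi> * H \<eta>) * sinh_kernel \<alpha> (\<eta> - \<xi>)) \<partial>lborel) \<partial>lborel))"
proof -
  let ?c = "chart a b"
  let ?w = "\<lambda>\<xi>. (b - a) / 2 * (1 - (tanh \<xi>)\<^sup>2)"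
  let ?r = "((b - a) / 2) powr (1 - \<alpha>)"
  define u' where "u' x = indicator {a<..<b} x * u x" for x
  have [measurable]: "u' \<in> borel_measurable borel"
    using borel_measurable_continuous_on_indicator[OF _ u] by (simp add: u'_def[abs_def])
  have [measurable]: "H \<in> borel_measurable borel" "v \<in> borel_measurable borel"
    unfolding H_def v_def using borel_measurable_log_profile[OF ab u] by auto
  have w0: "0 \<le> ?w \<xi>" for \<xi> using ab by (simp add: one_minus_tanh_sq)
  have u'_chart: "u' (?c \<xi>) = v \<xi> / H \<xi>" for \<xi>
    using chart_in[OF ab, of \<xi>] cosh_weight_pos[of \<alpha> \<xi>] by (simp add: u'_def v_def H_def log_profile_def)
  let ?e = "\<lambda>x y. ennreal ((u' x - u' y)\<^sup>2 / \<bar>x - y\<bar> powr (1 + \<alpha>))"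
  have "(\<integral>\<^sup>+x\<in>{a<..<b}. (\<integral>\<^sup>+y\<in>{a<..<b}.
        ennreal ((u x - u y)\<^sup>2 / \<bar>x - y\<bar> powr (1 + \<alpha>)) \<partial>lborel) \<partial>lborel)
      = (\<integral>\<^sup>+x. (\<integral>\<^sup>+y. ?e x y * indicator {a<..<b} y \<partial>lborel) * indicator {a<..<b} x \<partial>lborel)"
    by (intro nn_integral_cong) (auto simp: u'_def intro!: nn_integral_cong split: split_indicator)
  also have "\<dots> = (\<integral>\<^sup>+x. (\<integral>\<^sup>+\<eta>. ?e x (?c \<eta>) * ennreal (?w \<eta>) \<partial>lborel) * indicator {a<..<b} x \<partial>lborel)"
    by (subst nn_integral_chart[OF ab, of "?e _"]) auto
  also have "\<dots> = (\<integral>\<^sup>+\<xi>. (\<integral>\<^sup>+\<eta>. ?e (?c \<xi>) (?c \<eta>) * ennreal (?w \<eta>) \<partial>lborel) * ennreal (?w \<xi>) \<partial>lborel)"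
    by (rule nn_integral_chart[OF ab]) measurable
  also have "\<dots> = (\<integral>\<^sup>+\<xi>. (\<integral>\<^sup>+\<eta>. ennreal ((v \<xi> / H \<xi> - v \<eta> / H \<eta>)\<^sup>2 * (H \<xi> * H \<eta>) * sinh_kernel \<alpha> (\<eta> - \<xi>) * ?r) \<partial>lborel) \<partial>lborel)"
  proof (intro nn_integral_cong)
    fix \<xi> :: real
    have "?e (?c \<xi>) (?c \<eta>) * ennreal (?w \<eta>) * ennreal (?w \<xi>)
        = ennreal ((v \<xi> / H \<xi> - v \<eta> / H \<eta>)\<^sup>2 * (H \<xi> * H \<eta>) * sinh_kernel \<alpha> (\<eta> - \<xi>) * ?r)" for \<eta>
    proof -
      have "?e (?c \<xi>) (?c \<eta>) * ennreal (?w \<eta>) * ennreal (?w \<xi>)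
          = ennreal ((u' (?c \<xi>) - u' (?c \<eta>))\<^sup>2 / \<bar>?c \<xi> - ?c \<eta>\<bar> powr (1 + \<alpha>) * ?w \<eta> * ?w \<xi>)"
        by (simp only: ennreal_mult''[OF w0])
      also have "(u' (?c \<xi>) - u' (?c \<eta>))\<^sup>2 / \<bar>?c \<xi> - ?c \<eta>\<bar> powr (1 + \<alpha>) * ?w \<eta> * ?w \<xi>
          = (u' (?c \<xi>) - u' (?c \<eta>))\<^sup>2 * (1 / \<bar>?c \<xi> - ?c \<eta>\<bar> powr (1 + \<alpha>) * ?w \<eta> * ?w \<xi>)"
        by simp
      also have "\<dots> = (v \<xi> / H \<xi> - v \<eta> / H \<eta>)\<^sup>2 * (H \<xi> * H \<eta>) * sinh_kernel \<alpha> (\<eta> - \<xi>) * ?r"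
        unfolding kernel_in_chart[OF ab] u'_chart H_def by (simp only: ac_simps)
      finally show ?thesis .
    qed
    then show "(\<integral>\<^sup>+\<eta>. ?e (?c \<xi>) (?c \<eta>) * ennreal (?w \<eta>) \<partial>lborel) * ennreal (?w \<xi>)
        = (\<integral>\<^sup>+\<eta>. ennreal ((v \<xi> / H \<xi> - v \<eta> / H \<eta>)\<^sup>2 * (H \<xi> * H \<eta>) * sinh_kernel \<alpha> (\<eta> - \<xi>) * ?r) \<partial>lborel)"
      by (subst nn_integral_multc[symmetric]) auto
  qed
  also have "\<dots> = (\<integral>\<^sup>+\<xi>. ennreal ?r * (\<integral>\<^sup>+\<eta>. ennreal ((v \<xi> / H \<xi> - v \<eta> / H \<eta>)\<^sup>2 * (H \<xi> * H \<eta>) * sinh_kernel \<alpha> (\<eta> - \<xi>)) \<partial>lborel) \<partial>lborel)"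
    by (subst nn_integral_times_const) auto
  also have "\<dots> = ennreal ?r * (\<integral>\<^sup>+\<xi>. (\<integral>\<^sup>+\<eta>. ennreal ((v \<xi> / H \<xi> - v \<eta> / H \<eta>)\<^sup>2 * (H \<xi> * H \<eta>) * sinh_kernel \<alpha> (\<eta> - \<xi>)) \<partial>lborel) \<partial>lborel)"
    by (rule nn_integral_cmult) measurable
  finally show ?thesis by (simp add: energy_def)
qed

text \<open>In the chart \<open>1 / (x - a) + 1 / (b - x) = 2 * (cosh \<xi>)\<^sup>2 / r\<close>. For \<open>s = \<alpha>\<close> the power of \<open>cosh\<close> on the right
disappears, and for \<open>s = \<alpha> - 1\<close> it is \<open>1 - (tanh \<xi>)\<^sup>2\<close>.\<close>

lemma weight_in_chart:
  assumes ab: "a < b"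
  shows "(u (chart a b \<xi>))\<^sup>2 * (1 / (chart a b \<xi> - a) + 1 / (b - chart a b \<xi>)) powr s
      * ((b - a) / 2 * (1 - (tanh \<xi>)\<^sup>2))
    = 2 powr s * ((b - a) / 2) powr (1 - s) * ((log_profile \<alpha> a b u \<xi>)\<^sup>2 * cosh \<xi> powr (2 * (s - \<alpha>)))"
proof -
  define r where "r = (b - a) / 2"
  have r: "0 < r" using ab by (simp add: r_def)
  have t: "0 < 1 + tanh \<xi>" "0 < 1 - tanh \<xi>" using tanh_real_bounds[of \<xi>] by auto
  have c: "chart a b \<xi> - a = r * (1 + tanh \<xi>)" "b - chart a b \<xi> = r * (1 - tanh \<xi>)"
    by (auto simp: chart_def r_def field_simps)
  have sum: "1 / (r * A) + 1 / (r * B) = (A + B) / (r * (A * B))" if "0 < A" "0 < B" for A B :: real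
    using that r by (simp add: field_simps)
  have "1 / (chart a b \<xi> - a) + 1 / (b - chart a b \<xi>) = 2 / (r * (1 - (tanh \<xi>)\<^sup>2))"
    unfolding c sum[OF t] by (simp add: power2_eq_square algebra_simps)
  also have "\<dots> = 2 * (cosh \<xi> powr 2) / r"
    using cosh_real_pos[of \<xi>] by (simp add: one_minus_tanh_sq)
  finally have e: "1 / (chart a b \<xi> - a) + 1 / (b - chart a b \<xi>) = 2 * (cosh \<xi> powr 2) / r" .
  have w: "(1 / (chart a b \<xi> - a) + 1 / (b - chart a b \<xi>)) powr s
      = 2 powr s * cosh \<xi> powr (2 * s) / r powr s"
    unfolding e by (simp only: powr_mult powr_divide powr_powr)
  have p: "r powr (1 - s) = r / r powr s" using powr_diff[of r 1 s] r by simp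
  have "(cosh_weight \<alpha> \<xi>)\<^sup>2 * cosh \<xi> powr (2 * (s - \<alpha>)) = cosh \<xi> powr (2 * s - 2)"
    by (simp add: cosh_weight_def power2_eq_square algebra_simps flip: powr_add)
  also have "\<dots> = cosh \<xi> powr (2 * s) * (1 / (cosh \<xi>)\<^sup>2)"
    using cosh_real_pos[of \<xi>] by (simp add: powr_diff)
  finally have q: "(cosh_weight \<alpha> \<xi>)\<^sup>2 * cosh \<xi> powr (2 * (s - \<alpha>)) = cosh \<xi> powr (2 * s) * (1 / (cosh \<xi>)\<^sup>2)" .
  show ?thesis
    unfolding w log_profile_def power_mult_distrib mult.assoc q r_def[symmetric] p one_minus_tanh_sq
    by (simp add: field_simps)
qed

lemma nn_weighted_integral_eq_log_profile:
  assumes ab: "a < b" and u: "continuous_on {a<..<b} u"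
  shows "(\<integral>\<^sup>+x. ennreal (indicator {a<..<b} x *\<^sub>R ((u x)\<^sup>2 * (1 / (x - a) + 1 / (b - x)) powr s)) \<partial>lborel)
    = (\<integral>\<^sup>+\<xi>. ennreal (2 powr s * ((b - a) / 2) powr (1 - s) * ((log_profile \<alpha> a b u \<xi>)\<^sup>2 * cosh \<xi> powr (2 * (s - \<alpha>)))) \<partial>lborel)"
proof -
  define u' where "u' x = indicator {a<..<b} x * u x" for x
  have [measurable]: "u' \<in> borel_measurable borel"
    using borel_measurable_continuous_on_indicator[OF _ u] by (simp add: u'_def[abs_def])
  have u'_chart: "u' (chart a b \<xi>) = u (chart a b \<xi>)" for \<xi>
    using chart_in[OF ab, of \<xi>] by (simp add: u'_def)
  have "(\<integral>\<^sup>+x. ennreal (indicator {a<..<b} x *\<^sub>R ((u x)\<^sup>2 * (1 / (x - a) + 1 / (b - x)) powr s)) \<partial>lborel)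
      = (\<integral>\<^sup>+x. ennreal ((u' x)\<^sup>2 * (1 / (x - a) + 1 / (b - x)) powr s) * indicator {a<..<b} x \<partial>lborel)"
    by (intro nn_integral_cong) (auto simp: u'_def split: split_indicator)
  also have "\<dots> = (\<integral>\<^sup>+\<xi>. ennreal ((u (chart a b \<xi>))\<^sup>2 * (1 / (chart a b \<xi> - a) + 1 / (b - chart a b \<xi>)) powr s)
      * ennreal ((b - a) / 2 * (1 - (tanh \<xi>)\<^sup>2)) \<partial>lborel)"
    by (subst nn_integral_chart[OF ab]) (auto simp: u'_chart)
  also have "\<dots> = (\<integral>\<^sup>+\<xi>. ennreal (2 powr s * ((b - a) / 2) powr (1 - s) * ((log_profile \<alpha> a b u \<xi>)\<^sup>2 * cosh \<xi> powr (2 * (s - \<alpha>)))) \<partial>lborel)"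
    unfolding weight_in_chart[OF ab, of u _ s \<alpha>, symmetric]
    using ab by (subst ennreal_mult'') (auto simp: one_minus_tanh_sq)
  finally show ?thesis .
qed

lemma weighted_integral_eq_log_profile:
  assumes ab: "a < b" and u: "continuous_on {a<..<b} u"
  shows "weighted_integral s a b u
    = 2 powr s * ((b - a) / 2) powr (1 - s) * (LBINT \<xi>. (log_profile \<alpha> a b u \<xi>)\<^sup>2 * cosh \<xi> powr (2 * (s - \<alpha>)))"
proof -
  have [measurable]: "log_profile \<alpha> a b u \<in> borel_measurable borel"
    by (rule borel_measurable_log_profile[OF ab u])
  have "(\<lambda>x. indicator {a<..<b} x *\<^sub>R u x) \<in> borel_measurable borel"
    by (rule borel_measurable_continuous_on_indicator[OF _ u]) simp
  then have [measurable]: "(\<lambda>x. indicator {a<..<b} x * u x) \<in> borel_measurable borel" by simp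
  have "(\<lambda>x. indicator {a<..<b} x *\<^sub>R ((u x)\<^sup>2 * (1 / (x - a) + 1 / (b - x)) powr s))
     = (\<lambda>x. (indicator {a<..<b} x * u x)\<^sup>2 * (1 / (x - a) + 1 / (b - x)) powr s)"
    by (auto split: split_indicator)
  also have "\<dots> \<in> borel_measurable lborel" by measurable
  finally have m: "(\<lambda>x. indicator {a<..<b} x *\<^sub>R ((u x)\<^sup>2 * (1 / (x - a) + 1 / (b - x)) powr s)) \<in> borel_measurable lborel" .
  have "weighted_integral s a b u
      = enn2real (\<integral>\<^sup>+x. ennreal (indicator {a<..<b} x *\<^sub>R ((u x)\<^sup>2 * (1 / (x - a) + 1 / (b - x)) powr s)) \<partial>lborel)"
    unfolding weighted_integral_def set_lebesgue_integral_def
    by (rule integral_eq_nn_integral[OF m]) simp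
  also have "\<dots> = (LBINT \<xi>. 2 powr s * ((b - a) / 2) powr (1 - s) * ((log_profile \<alpha> a b u \<xi>)\<^sup>2 * cosh \<xi> powr (2 * (s - \<alpha>))))"
    unfolding nn_weighted_integral_eq_log_profile[OF ab u, of s \<alpha>]
    by (rule integral_eq_nn_integral[symmetric]) auto
  finally show ?thesis by simp
qed

text \<open>Up to a constant this is the weighted integral with exponent \<open>\<alpha>\<close>, whose integrand is continuous and
supported in a compact subset of \<open>(a, b)\<close>.\<close>

lemma nn_integral_log_profile_finite:
  assumes ab: "a < b" and u: "u \<in> Cc a b"
  shows "(\<integral>\<^sup>+\<xi>. ennreal ((log_profile \<alpha> a b u \<xi>)\<^sup>2) \<partial>lborel) < \<infinity>"
proof -
  define K where "K = closure {x \<in> {a<..<b}. u x \<noteq> 0}"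
  have u: "continuous_on {a<..<b} u" "compact K" "K \<subseteq> {a<..<b}"
    using u by (auto simp: Cc_def K_def)
  have [measurable]: "log_profile \<alpha> a b u \<in> borel_measurable borel"
    by (rule borel_measurable_log_profile[OF ab u(1)])
  let ?f = "\<lambda>x. (u x)\<^sup>2 * (1 / (x - a) + 1 / (b - x)) powr \<alpha>"
  let ?C = "2 powr \<alpha> * ((b - a) / 2) powr (1 - \<alpha>)"
  have "continuous_on K ?f"
  proof -
    have "1 / (x - a) + 1 / (b - x) \<noteq> 0" if "x \<in> K" for x
    proof -
      have "0 < 1 / (x - a)" "0 < 1 / (b - x)" using u(3) that by auto
      then show ?thesis by linarith
    qed
    then show ?thesis
      using u(3) by (intro continuous_intros continuous_on_subset[OF u(1)]) auto
  qed
  from borel_integrable_compact[OF u(2) this]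
  have int: "integrable lborel (\<lambda>x. indicator K x *\<^sub>R ?f x)" .
  have "(\<lambda>x. indicator K x *\<^sub>R ?f x) = (\<lambda>x. indicator {a<..<b} x *\<^sub>R ?f x)"
  proof
    show "indicator K x *\<^sub>R ?f x = indicator {a<..<b} x *\<^sub>R ?f x" for x
      using u(3) closure_subset[of "{x \<in> {a<..<b}. u x \<noteq> 0}"]
      by (cases "u x = 0") (auto simp: K_def split: split_indicator)
  qed
  with int have "integrable lborel (\<lambda>x. indicator {a<..<b} x *\<^sub>R ?f x)" by (simp only:)
  from integrableD(2)[OF this] have "(\<integral>\<^sup>+x. ennreal (indicator {a<..<b} x *\<^sub>R ?f x) \<partial>lborel) < \<infinity>"
    by (simp add: abs_mult real_integrable_def top.not_eq_extremum)
  also have "(\<integral>\<^sup>+x. ennreal (indicator {a<..<b} x *\<^sub>R ?f x) \<partial>lborel)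
      = (\<integral>\<^sup>+\<xi>. ennreal ((log_profile \<alpha> a b u \<xi>)\<^sup>2 * ?C) \<partial>lborel)"
    unfolding nn_weighted_integral_eq_log_profile[OF ab u(1), of \<alpha> \<alpha>]
    using cosh_real_nonzero by (simp add: mult.commute)
  also have "\<dots> = ennreal ?C * (\<integral>\<^sup>+\<xi>. ennreal ((log_profile \<alpha> a b u \<xi>)\<^sup>2) \<partial>lborel)"
    by (rule nn_integral_times_const) auto
  finally show ?thesis using ab by (auto simp: ennreal_mult_less_top)
qed

lemma integrable_log_profile:
  assumes ab: "a < b" and u: "u \<in> Cc a b"
  shows "integrable lborel (\<lambda>\<xi>. (log_profile \<alpha> a b u \<xi>)\<^sup>2)"
    and "integrable lborel (\<lambda>\<xi>. (log_profile \<alpha> a b u \<xi>)\<^sup>2 * (1 - (tanh \<xi>)\<^sup>2))"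
proof -
  have [measurable]: "log_profile \<alpha> a b u \<in> borel_measurable borel"
    using u by (intro borel_measurable_log_profile[OF ab]) (simp add: Cc_def)
  show 1: "integrable lborel (\<lambda>\<xi>. (log_profile \<alpha> a b u \<xi>)\<^sup>2)"
    using nn_integral_log_profile_finite[OF ab u] by (intro integrableI_bounded) auto
  have "(log_profile \<alpha> a b u \<xi>)\<^sup>2 * (1 - (tanh \<xi>)\<^sup>2) \<le> (log_profile \<alpha> a b u \<xi>)\<^sup>2 * 1" for \<xi>
    by (intro mult_left_mono) auto
  moreover have "0 \<le> 1 - (tanh \<xi>)\<^sup>2" for \<xi> :: real by (simp add: one_minus_tanh_sq)
  ultimately show "integrable lborel (\<lambda>\<xi>. (log_profile \<alpha> a b u \<xi>)\<^sup>2 * (1 - (tanh \<xi>)\<^sup>2))"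
    by (intro Bochner_Integration.integrable_bound[OF 1]) (auto simp: abs_mult)
qed

text \<open>Neither of the two terms is negative. The first one measures only the increments of \<open>v\<close>, so it is
negligible for slowly varying \<open>v\<close>; the second one contains the Hardy weight.\<close>

lemma energy_decomposition:
  assumes \<alpha>: "1 < \<alpha>" "\<alpha> < 2" and ab: "a < b" and u: "u \<in> Cc a b"
  defines "v \<equiv> log_profile \<alpha> a b u"
  shows "energy \<alpha> a b u = ennreal (1 / 2) * (ennreal (((b - a) / 2) powr (1 - \<alpha>)) *
    ((\<integral>\<^sup>+s. ennreal (sinh_kernel \<alpha> s) * (\<integral>\<^sup>+\<xi>. ennreal ((v \<xi> - v (\<xi> + s))\<^sup>2) \<partial>lborel) \<partial>lborel)
     + (\<integral>\<^sup>+\<xi>. ennreal ((v \<xi>)\<^sup>2 * (2 * ground_potential \<alpha> (tanh \<xi>))) \<partial>lborel)))"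
proof -
  have cont: "continuous_on {a<..<b} u" using u by (simp add: Cc_def)
  have m: "v \<in> borel_measurable borel"
    unfolding v_def by (rule borel_measurable_log_profile[OF ab cont])
  have fin: "(\<integral>\<^sup>+\<xi>. ennreal ((v \<xi>)\<^sup>2) \<partial>lborel) < \<infinity>"
    unfolding v_def by (rule nn_integral_log_profile_finite[OF ab u])
  show ?thesis
    unfolding energy_eq_log_profile[OF ab cont] v_def[symmetric]
      ground_state_identity[OF \<alpha>(1) m fin] nn_integral_second_difference[OF \<alpha>]
    by (simp only: ennreal_mult'[symmetric] zero_le_power2)
qed

lemma hardy_right_side_in_chart:
  assumes \<alpha>: "1 < \<alpha>" and ab: "a < b" and u: "continuous_on {a<..<b} u"
  defines "v \<equiv> log_profile \<alpha> a b u"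
  shows "c * weighted_integral \<alpha> a b u
      + (4 - 2 powr (3 - \<alpha>)) / (\<alpha> * (b - a)) * weighted_integral (\<alpha> - 1) a b u
    = ((b - a) / 2) powr (1 - \<alpha>) * (c * 2 powr \<alpha> * (LBINT \<xi>. (v \<xi>)\<^sup>2)
        + (2 powr \<alpha> - 2) / \<alpha> * (LBINT \<xi>. (v \<xi>)\<^sup>2 * (1 - (tanh \<xi>)\<^sup>2)))"
proof -
  define r where "r = (b - a) / 2"
  have r: "0 < r" "b - a = 2 * r" using ab by (simp_all add: r_def)
  have 0: "cosh \<xi> powr (2 * (\<alpha> - \<alpha>)) = 1" for \<xi> :: real by simp
  have 1: "cosh \<xi> powr (2 * (\<alpha> - 1 - \<alpha>)) = 1 - (tanh \<xi>)\<^sup>2" for \<xi> :: real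
    using one_minus_tanh_sq_powr[of \<xi> 1] one_minus_tanh_sq[of \<xi>] by simp
  have r2: "r powr (1 - (\<alpha> - 1)) = r * r powr (1 - \<alpha>)"
    using powr_mult_base[of r "1 - \<alpha>"] r by simp
  have t2: "(4 - 2 powr (3 - \<alpha>)) * 2 powr (\<alpha> - 1) = 2 * (2 powr \<alpha> - 2)"
  proof -
    have "2 powr (3 - \<alpha>) * 2 powr (\<alpha> - 1) = (4::real)" by (simp flip: powr_add)
    moreover have "2 * 2 powr (\<alpha> - 1) = (2::real) powr \<alpha>" using powr_mult_base[of 2 "\<alpha> - 1"] by simp
    ultimately show ?thesis by (simp add: algebra_simps)
  qed
  let ?M = "LBINT \<xi>. (v \<xi>)\<^sup>2 * (1 - (tanh \<xi>)\<^sup>2)"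
  have W0: "weighted_integral \<alpha> a b u = 2 powr \<alpha> * r powr (1 - \<alpha>) * (LBINT \<xi>. (v \<xi>)\<^sup>2)"
    unfolding weighted_integral_eq_log_profile[OF ab u, of \<alpha> \<alpha>] 0 v_def r_def by simp
  have W1: "weighted_integral (\<alpha> - 1) a b u = 2 powr (\<alpha> - 1) * (r * r powr (1 - \<alpha>)) * ?M"
    unfolding weighted_integral_eq_log_profile[OF ab u, of "\<alpha> - 1" \<alpha>] 1 v_def r_def[symmetric] r2 by simp
  have "(4 - 2 powr (3 - \<alpha>)) / (\<alpha> * (b - a)) * weighted_integral (\<alpha> - 1) a b u
      = ((4 - 2 powr (3 - \<alpha>)) * 2 powr (\<alpha> - 1)) * r powr (1 - \<alpha>) * ?M / (2 * \<alpha>)"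
    unfolding W1 r(2) using r(1) \<alpha> by (simp add: field_simps)
  also have "\<dots> = r powr (1 - \<alpha>) * ((2 powr \<alpha> - 2) / \<alpha> * ?M)"
    unfolding t2 using \<alpha> by (simp add: field_simps)
  finally show ?thesis
    unfolding W0 r_def[symmetric] by (simp add: algebra_simps)
qed

section \<open>The Hardy inequality\<close>

text \<open>Passing to the positive part can only increase the Bochner integral, and it leaves the right-hand side
unchanged.\<close>

lemma ennreal_integral_le_nn_integral:
  assumes "integrable M f"
  shows "ennreal (integral\<^sup>L M f) \<le> (\<integral>\<^sup>+x. ennreal (f x) \<partial>M)"
proof -
  have "integral\<^sup>L M f \<le> integral\<^sup>L M (\<lambda>x. max 0 (f x))"
    using assms by (intro integral_mono integrable_max) auto
  then have "ennreal (integral\<^sup>L M f) \<le> ennreal (integral\<^sup>L M (\<lambda>x. max 0 (f x)))"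
    by (rule ennreal_leI)
  also have "\<dots> = (\<integral>\<^sup>+x. ennreal (max 0 (f x)) \<partial>M)"
    using assms by (intro nn_integral_eq_integral[symmetric] integrable_max) auto
  also have "\<dots> = (\<integral>\<^sup>+x. ennreal (f x) \<partial>M)"
    by (intro nn_integral_cong) (auto simp: max_def ennreal_neg)
  finally show ?thesis .
qed

text \<open>The translation invariant part of \<open>energy_decomposition\<close> is dropped, and \<open>ground_potential_lower\<close> is used
under the remaining integral.\<close>

lemma hardy_inequality_kappa1:
  assumes \<alpha>: "1 < \<alpha>" "\<alpha> < 2" and ab: "a < b" and u: "u \<in> Cc a b"
  shows "hardy_inequality (kappa1 \<alpha>) \<alpha> a b u"
proof -
  define v where "v = log_profile \<alpha> a b u"
  define \<rho> where "\<rho> = ((b - a) / 2) powr (1 - \<alpha>)"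
  have \<rho>: "0 \<le> \<rho>" by (simp add: \<rho>_def)
  have cont: "continuous_on {a<..<b} u" using u by (simp add: Cc_def)
  have [measurable]: "v \<in> borel_measurable borel"
    unfolding v_def by (rule borel_measurable_log_profile[OF ab cont])
  note int = integrable_log_profile[OF ab u, of \<alpha>, folded v_def]
  let ?V = "\<lambda>\<xi>. ground_potential \<alpha> (tanh \<xi>)"
  let ?g = "\<lambda>\<xi>. \<rho> * (kappa1 \<alpha> * 2 powr \<alpha> * (v \<xi>)\<^sup>2 + (2 powr \<alpha> - 2) / \<alpha> * ((v \<xi>)\<^sup>2 * (1 - (tanh \<xi>)\<^sup>2)))"
  have rhs: "kappa1 \<alpha> * weighted_integral \<alpha> a b u
      + (4 - 2 powr (3 - \<alpha>)) / (\<alpha> * (b - a)) * weighted_integral (\<alpha> - 1) a b u = (LBINT \<xi>. ?g \<xi>)"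
    unfolding hardy_right_side_in_chart[OF \<alpha>(1) ab cont] v_def[symmetric] \<rho>_def[symmetric]
    using int by simp
  have "ennreal (LBINT \<xi>. ?g \<xi>) \<le> (\<integral>\<^sup>+\<xi>. ennreal (?g \<xi>) \<partial>lborel)"
    using int by (intro ennreal_integral_le_nn_integral) simp
  also have "\<dots> \<le> (\<integral>\<^sup>+\<xi>. ennreal ((v \<xi>)\<^sup>2 * (2 * ?V \<xi>) * (\<rho> / 2)) \<partial>lborel)"
  proof (rule nn_integral_mono, rule ennreal_leI)
    fix \<xi> :: real
    have "\<rho> * (k * w + m * (w * t)) = \<rho> * (w * (k + m * t))" for k m w t :: real
      by (simp add: algebra_simps)
    then have "?g \<xi> = \<rho> * ((v \<xi>)\<^sup>2 * (kappa1 \<alpha> * 2 powr \<alpha> + (2 powr \<alpha> - 2) / \<alpha> * (1 - (tanh \<xi>)\<^sup>2)))"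
      .
    also have "\<rho> * ((v \<xi>)\<^sup>2 * (kappa1 \<alpha> * 2 powr \<alpha> + (2 powr \<alpha> - 2) / \<alpha> * (1 - (tanh \<xi>)\<^sup>2))) \<le> \<rho> * ((v \<xi>)\<^sup>2 * ?V \<xi>)"
    proof (intro mult_left_mono \<rho> zero_le_power2)
      show "kappa1 \<alpha> * 2 powr \<alpha> + (2 powr \<alpha> - 2) / \<alpha> * (1 - (tanh \<xi>)\<^sup>2) \<le> ?V \<xi>"
        using tanh_real_bounds[of \<xi>] by (intro ground_potential_lower[OF \<alpha>]) auto
    qed
    also have "\<dots> = (v \<xi>)\<^sup>2 * (2 * ?V \<xi>) * (\<rho> / 2)" by simp
    finally show "?g \<xi> \<le> (v \<xi>)\<^sup>2 * (2 * ?V \<xi>) * (\<rho> / 2)" .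
  qed
  also have "\<dots> = ennreal (1 / 2) * (ennreal \<rho> * (\<integral>\<^sup>+\<xi>. ennreal ((v \<xi>)\<^sup>2 * (2 * ?V \<xi>)) \<partial>lborel))"
  proof -
    have "ennreal (\<rho> / 2) = ennreal (1 / 2) * ennreal \<rho>"
      using ennreal_mult'[of "1 / 2" \<rho>] by simp
    then show ?thesis
      using \<rho> by (subst nn_integral_times_const) (auto simp: ground_potential_def mult.assoc)
  qed
  also have "\<dots> \<le> energy \<alpha> a b u"
    unfolding energy_decomposition[OF \<alpha> ab u] v_def[symmetric] \<rho>_def[symmetric]
    by (intro mult_left_mono) auto
  finally show ?thesis unfolding hardy_inequality_def rhs .
qed

section \<open>Sharpness of the constant\<close>

lemma tanh_artanh_real:
  fixes y :: real
  assumes "\<bar>y\<bar> < 1"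
  shows "tanh (artanh y) = y"
proof -
  have y: "0 < 1 + y" "0 < 1 - y" using assms by auto
  have "- 2 * artanh y = ln (1 - y) - ln (1 + y)"
    using y by (simp add: artanh_def ln_div)
  then have e: "exp (- 2 * artanh y) = (1 - y) / (1 + y)"
    using y by (simp add: exp_diff)
  show ?thesis
    unfolding tanh_real_altdef e using y by (simp add: field_simps)
qed

definition tent :: "real \<Rightarrow> real \<Rightarrow> real" where
  "tent N \<xi> = max 0 (1 - \<bar>\<xi>\<bar> / N)"

text \<open>The function on \<open>(a, b)\<close> whose \<open>log_profile\<close> is the tent; it is the ground state times a cutoff that
varies slowly in the coordinate of the chart.\<close>

definition tent_profile :: "real \<Rightarrow> real \<Rightarrow> real \<Rightarrow> real \<Rightarrow> real \<Rightarrow> real" where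
  "tent_profile \<alpha> a b N x =
     (let \<xi> = artanh ((x - (a + b) / 2) / ((b - a) / 2)) in tent N \<xi> / cosh_weight \<alpha> \<xi>)"

lemma tent_bounds: "0 \<le> tent N \<xi>" "0 < N \<Longrightarrow> tent N \<xi> \<le> 1"
  by (auto simp: tent_def)

lemma tent_eq_0: "0 < N \<Longrightarrow> N \<le> \<bar>\<xi>\<bar> \<Longrightarrow> tent N \<xi> = 0"
  by (simp add: tent_def field_simps)

lemma tent_lipschitz:
  assumes N: "0 < N"
  shows "\<bar>tent N \<xi> - tent N \<eta>\<bar> \<le> \<bar>\<xi> - \<eta>\<bar> / N"
proof -
  have "\<bar>tent N \<xi> - tent N \<eta>\<bar> \<le> \<bar>(1 - \<bar>\<xi>\<bar> / N) - (1 - \<bar>\<eta>\<bar> / N)\<bar>"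
    unfolding tent_def by linarith
  also have "\<dots> = \<bar>\<bar>\<eta>\<bar> - \<bar>\<xi>\<bar>\<bar> / N"
    using N by (simp add: diff_divide_distrib[symmetric])
  also have "\<dots> \<le> \<bar>\<xi> - \<eta>\<bar> / N"
    using N by (intro divide_right_mono) linarith+
  finally show ?thesis .
qed

lemma continuous_on_tent: "continuous_on A (tent N)"
  unfolding tent_def by (cases "N = 0") (auto intro!: continuous_intros)

lemma borel_measurable_tent [measurable]: "tent N \<in> borel_measurable borel"
  by (rule borel_measurable_continuous_onI[OF continuous_on_tent])

lemma log_profile_tent_profile:
  assumes "a < b"
  shows "log_profile \<alpha> a b (tent_profile \<alpha> a b N) = tent N"
proof
  fix \<xi>
  have "(chart a b \<xi> - (a + b) / 2) / ((b - a) / 2) = tanh \<xi>"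
    using assms by (simp add: chart_def)
  then have "tent_profile \<alpha> a b N (chart a b \<xi>) = tent N \<xi> / cosh_weight \<alpha> \<xi>"
    unfolding tent_profile_def by (simp only: artanh_tanh_real Let_def)
  then show "log_profile \<alpha> a b (tent_profile \<alpha> a b N) \<xi> = tent N \<xi>"
    using cosh_weight_pos[of \<alpha> \<xi>] by (simp add: log_profile_def)
qed

lemma tent_profile_in_Cc:
  assumes ab: "a < b" and N: "0 < N"
  shows "tent_profile \<alpha> a b N \<in> Cc a b"
proof -
  let ?y = "\<lambda>x. (x - (a + b) / 2) / ((b - a) / 2)"
  let ?u = "tent_profile \<alpha> a b N"
  have y: "\<bar>?y x\<bar> < 1" if "x \<in> {a<..<b}" for x
  proof -
    have "\<bar>x - (a + b) / 2\<bar> < (b - a) / 2" using that by (auto simp: abs_less_iff field_simps)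
    then have "\<bar>x - (a + b) / 2\<bar> / ((b - a) / 2) < 1" using ab by (subst divide_less_eq_1) auto
    moreover have "\<bar>(b - a) / 2\<bar> = (b - a) / 2" using ab by simp
    ultimately show ?thesis by (simp only: abs_divide[of "x - (a + b) / 2" "(b - a) / 2"])
  qed
  have y': "?y x \<in> {-1<..<1}" if "x \<in> {a<..<b}" for x
    using y[OF that] unfolding abs_less_iff greaterThanLessThan_iff by linarith
  have "continuous_on {a<..<b} ?y"
    using ab by (intro continuous_intros) auto
  then have art: "continuous_on {a<..<b} (\<lambda>x. artanh (?y x))"
    by (rule continuous_on_artanh'[OF _ y'])
  have cont: "continuous_on {a<..<b} ?u"
    unfolding tent_profile_def Let_def cosh_weight_def
    by (intro continuous_intros continuous_on_compose2[OF continuous_on_tent art] art) auto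
  define K where "K = chart a b ` {- N..N}"
  have "continuous_on {- N..N} (chart a b)"
    unfolding chart_def by (intro continuous_intros) auto
  then have K: "compact K" unfolding K_def by (intro compact_continuous_image) auto
  have Ksub: "K \<subseteq> {a<..<b}" using chart_in[OF ab] by (auto simp: K_def simp del: greaterThanLessThan_iff)
  have "{x \<in> {a<..<b}. ?u x \<noteq> 0} \<subseteq> K"
  proof (clarify)
    fix x assume x: "x \<in> {a<..<b}" and ux: "?u x \<noteq> 0"
    have "tent N (artanh (?y x)) \<noteq> 0" using ux by (auto simp: tent_profile_def Let_def)
    then have "\<bar>artanh (?y x)\<bar> < N" using tent_eq_0[OF N, of "artanh (?y x)"] by linarith
    moreover have "x = chart a b (artanh (?y x))"
    proof -
      have "c * (z / c) = z" if "c \<noteq> 0" for c z :: real using that by simp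
      from this[of "(b - a) / 2" "x - (a + b) / 2"] show ?thesis
        unfolding chart_def tanh_artanh_real[OF y[OF x]] using ab by simp
    qed
    ultimately show "x \<in> K" unfolding K_def by (intro image_eqI[of _ _ "artanh (?y x)"]) auto
  qed
  then have "closure {x \<in> {a<..<b}. ?u x \<noteq> 0} \<subseteq> K"
    using K by (intro closure_minimal compact_imp_closed)
  moreover from this have "compact (closure {x \<in> {a<..<b}. ?u x \<noteq> 0})"
    using K compact_Int_closed[OF K closed_closure] by (metis Int_absorb1)
  ultimately show ?thesis using cont Ksub by (auto simp: Cc_def simp del: greaterThanLessThan_iff)
qed

text \<open>The increment is at most \<open>\<bar>s\<bar> / N\<close>, and it vanishes unless \<open>\<xi>\<close> or \<open>\<xi> + s\<close> lies in \<open>[-N, N]\<close>.\<close>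

lemma nn_integral_tent_increment:
  assumes N: "0 < N"
  shows "(\<integral>\<^sup>+\<xi>. ennreal ((tent N \<xi> - tent N (\<xi> + s))\<^sup>2) \<partial>lborel) \<le> ennreal (4 / N * s\<^sup>2)"
proof -
  let ?I = "indicator {- N..N} :: real \<Rightarrow> real"
  have ind: "(\<integral>\<^sup>+\<xi>. ennreal (?I \<xi>) \<partial>lborel) = ennreal (2 * N)"
    using N by (simp add: ennreal_indicator)
  have shift: "(\<integral>\<^sup>+\<xi>. ennreal (?I (\<xi> + s)) \<partial>lborel) = ennreal (2 * N)"
    unfolding ind[symmetric] by (rule nn_integral_shift) measurable
  have pw: "(tent N \<xi> - tent N (\<xi> + s))\<^sup>2 \<le> (?I \<xi> + ?I (\<xi> + s)) * (s / N)\<^sup>2" for \<xi>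
  proof (cases "\<xi> \<in> {- N..N} \<or> \<xi> + s \<in> {- N..N}")
    case True
    have "(tent N \<xi> - tent N (\<xi> + s))\<^sup>2 \<le> (s / N)\<^sup>2"
      using tent_lipschitz[OF N, of \<xi> "\<xi> + s"] N by (simp add: abs_le_square_iff[symmetric])
    also have "\<dots> \<le> (?I \<xi> + ?I (\<xi> + s)) * (s / N)\<^sup>2"
    proof -
      have "1 * (s / N)\<^sup>2 \<le> (?I \<xi> + ?I (\<xi> + s)) * (s / N)\<^sup>2"
        using True by (intro mult_right_mono) (auto split: split_indicator)
      then show ?thesis by simp
    qed
    finally show ?thesis .
  next
    case False
    then have "N \<le> \<bar>\<xi>\<bar>" "N \<le> \<bar>\<xi> + s\<bar>" by auto
    then show ?thesis using tent_eq_0[OF N] by simp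
  qed
  have "(\<integral>\<^sup>+\<xi>. ennreal ((tent N \<xi> - tent N (\<xi> + s))\<^sup>2) \<partial>lborel)
      \<le> (\<integral>\<^sup>+\<xi>. ennreal ((?I \<xi> + ?I (\<xi> + s)) * (s / N)\<^sup>2) \<partial>lborel)"
    by (intro nn_integral_mono ennreal_leI pw)
  also have "\<dots> = ennreal ((s / N)\<^sup>2) * (\<integral>\<^sup>+\<xi>. ennreal (?I \<xi> + ?I (\<xi> + s)) \<partial>lborel)"
    by (rule nn_integral_times_const) auto
  also have "(\<integral>\<^sup>+\<xi>. ennreal (?I \<xi> + ?I (\<xi> + s)) \<partial>lborel) = ennreal (2 * N) + ennreal (2 * N)"
  proof -
    have "(\<integral>\<^sup>+\<xi>. ennreal (?I \<xi> + ?I (\<xi> + s)) \<partial>lborel)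
        = (\<integral>\<^sup>+\<xi>. ennreal (?I \<xi>) + ennreal (?I (\<xi> + s)) \<partial>lborel)"
      by (intro nn_integral_cong ennreal_plus) auto
    also have "\<dots> = (\<integral>\<^sup>+\<xi>. ennreal (?I \<xi>) \<partial>lborel) + (\<integral>\<^sup>+\<xi>. ennreal (?I (\<xi> + s)) \<partial>lborel)"
      by (rule nn_integral_add) measurable
    finally show ?thesis unfolding ind shift .
  qed
  also have "ennreal ((s / N)\<^sup>2) * (ennreal (2 * N) + ennreal (2 * N)) = ennreal (4 / N * s\<^sup>2)"
    using N by (simp add: power2_eq_square field_simps flip: ennreal_plus ennreal_mult')
  finally show ?thesis .
qed

text \<open>The tent is at least \<open>1 / 2\<close> on the middle half of its support.\<close>

lemma integral_tent_sq_lower: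
  assumes N: "0 < N" and int: "integrable lborel (\<lambda>\<xi>. (tent N \<xi>)\<^sup>2)"
  shows "N / 4 \<le> (LBINT \<xi>. (tent N \<xi>)\<^sup>2)"
proof -
  have i: "integrable lborel (\<lambda>\<xi>. 1 / 4 * indicator {- (N / 2)..N / 2} \<xi> :: real)"
    by (intro integrable_mult_right integrable_real_indicator) (auto simp: emeasure_lborel_Icc_eq)
  have "(LBINT \<xi>. 1 / 4 * indicator {- (N / 2)..N / 2} \<xi>) \<le> (LBINT \<xi>. (tent N \<xi>)\<^sup>2)"
  proof (rule integral_mono[OF i int])
    fix \<xi> :: real
    show "1 / 4 * indicator {- (N / 2)..N / 2} \<xi> \<le> (tent N \<xi>)\<^sup>2"
    proof (cases "\<xi> \<in> {- (N / 2)..N / 2}")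
      case True
      then have "1 / 2 \<le> tent N \<xi>" using N by (auto simp: tent_def field_simps)
      then have "(1 / 2)\<^sup>2 \<le> (tent N \<xi>)\<^sup>2" by (intro power_mono) auto
      then show ?thesis using True by (simp add: power2_eq_square)
    qed simp
  qed
  then show ?thesis using N by simp
qed

lemma nn_integral_one_minus_tanh_sq:
  "(\<integral>\<^sup>+\<xi>. ennreal (1 - (tanh \<xi>)\<^sup>2) \<partial>lborel) = 2"
  using nn_integral_chart[of "-1" 1 "\<lambda>_. 1"] by simp

text \<open>The translation invariant part is of order \<open>1 / N\<close>. In the potential part, \<open>ground_potential_upper\<close>
leaves apart from the main term only the integral of \<open>1 - (tanh \<xi>)\<^sup>2\<close>, which is 2 independently of \<open>N\<close>.\<close>

lemma energy_tent_profile_upper: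
  assumes \<alpha>: "1 < \<alpha>" "\<alpha> < 2" and ab: "a < b" and N: "0 < N"
  defines "\<rho> \<equiv> ((b - a) / 2) powr (1 - \<alpha>)" and "B1 \<equiv> Beta (1 - \<alpha> / 2) ((\<alpha> - 1) / 2)"
  shows "energy \<alpha> a b (tent_profile \<alpha> a b N)
    \<le> ennreal (\<rho> * (2 * B1 / N + kappa1 \<alpha> * 2 powr \<alpha> * (LBINT \<xi>. (tent N \<xi>)\<^sup>2) + 2 powr \<alpha>))"
proof -
  note mem = tent_profile_in_Cc[OF ab N, of \<alpha>]
  note int = integrable_log_profile[OF ab mem, of \<alpha>, unfolded log_profile_tent_profile[OF ab]]
  let ?M = "LBINT \<xi>. (tent N \<xi>)\<^sup>2"
  let ?M1 = "LBINT \<xi>. (tent N \<xi>)\<^sup>2 * (1 - (tanh \<xi>)\<^sup>2)"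
  let ?V = "\<lambda>\<xi>. ground_potential \<alpha> (tanh \<xi>)"
  have \<rho>: "0 \<le> \<rho>" by (simp add: \<rho>_def)
  have B1: "0 \<le> B1"
    unfolding B1_def using \<alpha> by (intro Beta_real_nonneg) auto
  have increments: "(\<integral>\<^sup>+s. ennreal (sinh_kernel \<alpha> s) * (\<integral>\<^sup>+\<xi>. ennreal ((tent N \<xi> - tent N (\<xi> + s))\<^sup>2) \<partial>lborel) \<partial>lborel)
      \<le> ennreal (4 / N * B1)"
  proof -
    have "(\<integral>\<^sup>+s. ennreal (sinh_kernel \<alpha> s) * (\<integral>\<^sup>+\<xi>. ennreal ((tent N \<xi> - tent N (\<xi> + s))\<^sup>2) \<partial>lborel) \<partial>lborel)
        \<le> (\<integral>\<^sup>+s. ennreal (sinh_kernel \<alpha> s) * ennreal (4 / N * s\<^sup>2) \<partial>lborel)"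
      by (intro nn_integral_mono mult_left_mono nn_integral_tent_increment N) auto
    also have "\<dots> = (\<integral>\<^sup>+s. ennreal ((s\<^sup>2 * sinh_kernel \<alpha> s) * (4 / N)) \<partial>lborel)"
      using N by (intro nn_integral_cong) (simp add: sinh_kernel_nonneg mult_ac flip: ennreal_mult')
    also have "\<dots> = ennreal (4 / N) * (\<integral>\<^sup>+s. ennreal (s\<^sup>2 * sinh_kernel \<alpha> s) \<partial>lborel)"
      using N by (intro nn_integral_times_const) auto
    also have "\<dots> \<le> ennreal (4 / N) * ennreal B1"
      unfolding B1_def by (intro mult_left_mono nn_integral_sq_sinh_kernel \<alpha>) auto
    also have "\<dots> = ennreal (4 / N * B1)"
      by (rule ennreal_mult'[symmetric]) (use N in simp)
    finally show ?thesis .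
  qed
  have M1: "?M1 \<le> 2"
  proof -
    have "ennreal ?M1 = (\<integral>\<^sup>+\<xi>. ennreal ((tent N \<xi>)\<^sup>2 * (1 - (tanh \<xi>)\<^sup>2)) \<partial>lborel)"
      using int(2) by (intro nn_integral_eq_integral[symmetric]) (auto simp: one_minus_tanh_sq)
    also have "\<dots> \<le> (\<integral>\<^sup>+\<xi>. ennreal (1 - (tanh \<xi>)\<^sup>2) \<partial>lborel)"
      using tent_bounds[of N] N
      by (intro nn_integral_mono ennreal_leI)
         (auto simp: one_minus_tanh_sq divide_right_mono power_le_one)
    finally have "ennreal ?M1 \<le> ennreal 2" by (simp add: nn_integral_one_minus_tanh_sq)
    then show ?thesis by (subst (asm) ennreal_le_iff) auto
  qed
  have potential: "(\<integral>\<^sup>+\<xi>. ennreal ((tent N \<xi>)\<^sup>2 * (2 * ?V \<xi>)) \<partial>lborel)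
      \<le> ennreal (2 * kappa1 \<alpha> * 2 powr \<alpha> * ?M + 2 powr \<alpha> * 2)"
  proof -
    let ?g = "\<lambda>\<xi>. 2 * kappa1 \<alpha> * 2 powr \<alpha> * (tent N \<xi>)\<^sup>2 + 2 powr \<alpha> * ((tent N \<xi>)\<^sup>2 * (1 - (tanh \<xi>)\<^sup>2))"
    have le: "(tent N \<xi>)\<^sup>2 * (2 * ?V \<xi>) \<le> ?g \<xi>" and nonneg: "0 \<le> (tent N \<xi>)\<^sup>2 * (2 * ?V \<xi>)" for \<xi>
    proof -
      have x: "\<bar>tanh \<xi>\<bar> < 1" using tanh_real_bounds[of \<xi>] by auto
      show "0 \<le> (tent N \<xi>)\<^sup>2 * (2 * ?V \<xi>)"
        using ground_potential_nonneg[OF \<alpha> x] by simp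
      have two: "2 * 2 powr (\<alpha> - 1) = (2::real) powr \<alpha>" using powr_mult_base[of 2 "\<alpha> - 1"] by simp
      have "(tent N \<xi>)\<^sup>2 * (2 * ?V \<xi>)
          \<le> (tent N \<xi>)\<^sup>2 * (2 * (kappa1 \<alpha> * 2 powr \<alpha> + 2 powr (\<alpha> - 1) * (1 - (tanh \<xi>)\<^sup>2)))"
        by (intro mult_left_mono ground_potential_upper[OF \<alpha> x]) auto
      also have "\<dots> = ?g \<xi>" unfolding two[symmetric] by (simp add: algebra_simps)
      finally show "(tent N \<xi>)\<^sup>2 * (2 * ?V \<xi>) \<le> ?g \<xi>" .
    qed
    have "(\<integral>\<^sup>+\<xi>. ennreal ((tent N \<xi>)\<^sup>2 * (2 * ?V \<xi>)) \<partial>lborel) \<le> (\<integral>\<^sup>+\<xi>. ennreal (?g \<xi>) \<partial>lborel)"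
      by (intro nn_integral_mono ennreal_leI le)
    also have "\<dots> = ennreal (LBINT \<xi>. ?g \<xi>)"
      using int order_trans[OF nonneg le] by (intro nn_integral_eq_integral) auto
    also have "\<dots> = ennreal (2 * kappa1 \<alpha> * 2 powr \<alpha> * ?M + 2 powr \<alpha> * ?M1)"
      using int by simp
    also have "\<dots> \<le> ennreal (2 * kappa1 \<alpha> * 2 powr \<alpha> * ?M + 2 powr \<alpha> * 2)"
      using M1 by (intro ennreal_leI add_left_mono mult_left_mono) auto
    finally show ?thesis .
  qed
  have "energy \<alpha> a b (tent_profile \<alpha> a b N)
      \<le> ennreal (1 / 2) * (ennreal \<rho> * (ennreal (4 / N * B1)
          + ennreal (2 * kappa1 \<alpha> * 2 powr \<alpha> * ?M + 2 powr \<alpha> * 2)))"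
    unfolding energy_decomposition[OF \<alpha> ab mem] log_profile_tent_profile[OF ab] \<rho>_def[symmetric]
    by (intro mult_left_mono add_mono increments potential) auto
  also have "\<dots> = ennreal (\<rho> * (2 * B1 / N + kappa1 \<alpha> * 2 powr \<alpha> * ?M + 2 powr \<alpha>))"
  proof -
    have "0 \<le> 4 / N * B1" using N B1 by simp
    moreover have "0 \<le> 2 * kappa1 \<alpha> * 2 powr \<alpha> * ?M + 2 powr \<alpha> * 2"
      using kappa1_nonneg[OF \<alpha>] by (intro add_nonneg_nonneg mult_nonneg_nonneg integral_nonneg_AE) auto
    ultimately have "ennreal (1 / 2) * (ennreal \<rho> * (ennreal (4 / N * B1)
          + ennreal (2 * kappa1 \<alpha> * 2 powr \<alpha> * ?M + 2 powr \<alpha> * 2)))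
        = ennreal (1 / 2 * (\<rho> * (4 / N * B1 + (2 * kappa1 \<alpha> * 2 powr \<alpha> * ?M + 2 powr \<alpha> * 2))))"
      using \<rho> by (subst ennreal_mult', simp, subst ennreal_mult', simp, subst ennreal_plus, simp_all)
    also have "1 / 2 * (\<rho> * (4 / N * B1 + (2 * kappa1 \<alpha> * 2 powr \<alpha> * ?M + 2 powr \<alpha> * 2)))
        = \<rho> * (2 * B1 / N + kappa1 \<alpha> * 2 powr \<alpha> * ?M + 2 powr \<alpha>)"
      by (simp add: algebra_simps)
    finally show ?thesis .
  qed
  finally show ?thesis .
qed

text \<open>For the tents both sides divided by \<open>r powr (1 - \<alpha>)\<close> are, up to bounded terms, \<open>kappa1 \<alpha>\<close> and \<open>c\<close> times
\<open>2 powr \<alpha>\<close> times the integral of the squared tent, which is at least \<open>N / 4\<close>. The remainder term on the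
right is nonnegative and only helps.\<close>

lemma hardy_inequality_fails_above_kappa1:
  assumes \<alpha>: "1 < \<alpha>" "\<alpha> < 2" and ab: "a < b" and c: "kappa1 \<alpha> < c"
  shows "\<exists>u\<in>Cc a b. \<not> hardy_inequality c \<alpha> a b u"
proof -
  define B1 where "B1 = Beta (1 - \<alpha> / 2) ((\<alpha> - 1) / 2)"
  define \<rho> where "\<rho> = ((b - a) / 2) powr (1 - \<alpha>)"
  have \<rho>: "0 < \<rho>" using ab by (simp add: \<rho>_def)
  have B1: "0 \<le> B1"
    unfolding B1_def using \<alpha> by (intro Beta_real_nonneg) auto
  define \<delta> where "\<delta> = (c - kappa1 \<alpha>) * 2 powr \<alpha>"
  have \<delta>: "0 < \<delta>" using c by (simp add: \<delta>_def)
  \<comment> \<open>Chosen so that \<open>\<delta> * (N / 4)\<close>, a lower bound for the gain, exceeds the bounded terms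
    \<open>2 * B1 + 2 powr \<alpha>\<close>.\<close>
  define N where "N = 1 + 4 * (2 * B1 + 2 powr \<alpha>) / \<delta>"
  have N1: "1 \<le> N" using B1 \<delta> by (simp add: N_def)
  then have N: "0 < N" by simp
  let ?u = "tent_profile \<alpha> a b N"
  note mem = tent_profile_in_Cc[OF ab N, of \<alpha>]
  have cont: "continuous_on {a<..<b} ?u" using mem by (simp add: Cc_def)
  note int = integrable_log_profile[OF ab mem, of \<alpha>, unfolded log_profile_tent_profile[OF ab]]
  let ?M = "LBINT \<xi>. (tent N \<xi>)\<^sup>2"
  let ?M1 = "LBINT \<xi>. (tent N \<xi>)\<^sup>2 * (1 - (tanh \<xi>)\<^sup>2)"
  have "0 \<le> ?M1" by (intro integral_nonneg_AE) (simp add: one_minus_tanh_sq)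
  moreover have "0 \<le> (2 powr \<alpha> - 2) / \<alpha>" using powr_mono[of 1 \<alpha> 2] \<alpha> by simp
  ultimately have rem: "0 \<le> (2 powr \<alpha> - 2) / \<alpha> * ?M1" by (rule mult_nonneg_nonneg[rotated])
  have "2 * B1 + 2 powr \<alpha> < \<delta> * (N / 4)"
    using \<delta> by (simp add: N_def field_simps)
  also have "\<dots> \<le> \<delta> * ?M"
    using \<delta> by (intro mult_left_mono integral_tent_sq_lower[OF N int(1)]) auto
  finally have "2 * B1 + 2 powr \<alpha> < \<delta> * ?M" .
  moreover have "2 * B1 / N \<le> 2 * B1"
    using N1 B1 N by (simp add: divide_le_eq mult_le_cancel_left1)
  ultimately have "2 * B1 / N + kappa1 \<alpha> * 2 powr \<alpha> * ?M + 2 powr \<alpha> < c * 2 powr \<alpha> * ?M"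
    by (simp add: \<delta>_def algebra_simps)
  with rem have less: "2 * B1 / N + kappa1 \<alpha> * 2 powr \<alpha> * ?M + 2 powr \<alpha>
      < c * 2 powr \<alpha> * ?M + (2 powr \<alpha> - 2) / \<alpha> * ?M1" (is "?lo < ?hi") by linarith
  have lo: "0 \<le> ?lo"
    using kappa1_nonneg[OF \<alpha>] B1 N
    by (intro add_nonneg_nonneg mult_nonneg_nonneg integral_nonneg_AE) auto
  have "energy \<alpha> a b ?u \<le> ennreal (\<rho> * ?lo)"
    unfolding \<rho>_def B1_def by (rule energy_tent_profile_upper[OF \<alpha> ab N])
  also have "\<dots> < ennreal (\<rho> * ?hi)"
    using less \<rho> lo by (subst ennreal_less_iff) auto
  finally have "energy \<alpha> a b ?u < ennreal (\<rho> * ?hi)" .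
  moreover have "\<rho> * ?hi = c * weighted_integral \<alpha> a b ?u
      + (4 - 2 powr (3 - \<alpha>)) / (\<alpha> * (b - a)) * weighted_integral (\<alpha> - 1) a b ?u"
    unfolding hardy_right_side_in_chart[OF \<alpha>(1) ab cont] log_profile_tent_profile[OF ab] \<rho>_def ..
  ultimately have "\<not> hardy_inequality c \<alpha> a b ?u"
    by (simp add: hardy_inequality_def not_le)
  with mem show ?thesis by blast
qed

theorem corollary2:
  fixes \<alpha> a b :: real
  assumes "1 < \<alpha>" and "\<alpha> < 2" and "a < b"
  shows "(\<forall>u\<in>Cc a b. hardy_inequality (kappa1 \<alpha>) \<alpha> a b u) \<and>
         (\<forall>c>kappa1 \<alpha>. \<exists>u\<in>Cc a b. \<not> hardy_inequality c \<alpha> a b u)"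
  using hardy_inequality_kappa1[OF assms] hardy_inequality_fails_above_kappa1[OF assms] by blast

end
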